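(* Let $\mathcal{M}$ be a compact, smooth, $n$-dimensional Riemannian manifold without boundary. Let $G:[0,\infty)\to\mathbb{R}$ be nonnegative, decreasing and continuous with $0<G(0)=C$ and $\lim_{x\to\infty}G(x)=0$, and let $\{\psi_j\}_{j\in\mathbb{Z}}$ be the wavelets generated by $G$. Then for every $m\ge1$ $$\|\overline{S}_2^mf-\overline{S}_2^mg\|_{\ell^2(\mathbb{Z}^m)}^2\le C^{2m}\,\|f-g\|_{\mathbf{L}^2(\mathcal{M})}^2$$ for all $f,g\in\mathbf{L}^2(\mathcal{M})$.
   Context: Setting: $\mathcal{M}$ is a compact, smooth, $n$-dimensional Riemannian manifold without boundary contained in $\mathbb{R}^d$, $d\ge n$, with Riemannian volume measure $\mu$ and Laplace-Beltrami operator $\Delta$. $\mathbf{L}^2(\mathcal{M})$ is the space of square-integrable $f:\mathcal{M}\to\mathbb{R}$. The eigenvalues of $-\Delta$ in increasing order are $\{\lambda_k\}_{k\in\mathbb{N}_0}$, with corresponding eigenfunctions $\{e_k\}_{k\in\mathbb{N}_0}$ forming an orthonormal basis of $\mathbf{L}^2(\mathcal{M})$, and $\hat f(k)=\int_{\mathcal{M}}f\,\overline{e_k}\,d\mu$. Wavelets: for $j\in\mathbb{Z}$, $\hat\psi_j(k)=\left[|G(2^{j-1}\lambda_k)|^2-|G(2^j\lambda_k)|^2\right]^{1/2}$, and $f\ast\psi_j=\sum_{k\in\mathbb{N}_0}\hat f(k)\hat\psi_j(k)e_k$. Scattering: $U[j]f=|f\ast\psi_j|$, $U[j_1,\dots,j_m]f=U[j_m]\cdots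 U[j_1]f$, $\overline{S}_2^m[j_1,\dots,j_m]f=\|U[j_1,\dots,j_m]f\|_{\mathbf{L}^2(\mathcal{M})}$ for $(j_1,\dots,j_m)\in\mathbb{Z}^m$. $\overline{S}_2^mf$ is the family of these numbers, and $\|a\|_{\ell^2(\mathbb{Z}^m)}^2=\sum_{(j_1,\dots,j_m)\in\mathbb{Z}^m}|a(j_1,\dots,j_m)|^2$. *)

theory Defs
  imports "HOL-Analysis.Analysis"
begin

section \<open>Smooth maps on open sets\<close>

text \<open>All the predicates below are meant for an open domain \<^term>\<open>U\<close>.\<close>

primrec Ck_on :: "nat \<Rightarrow> 'b::real_normed_vector set \<Rightarrow> ('b \<Rightarrow> 'c::real_normed_vector) \<Rightarrow> bool" where
  "Ck_on 0 U f \<longleftrightarrow> continuous_on U f"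
| "Ck_on (Suc k) U f \<longleftrightarrow>
     (\<forall>x\<in>U. f differentiable (at x)) \<and> (\<forall>v. Ck_on k U (\<lambda>x. frechet_derivative f (at x) v))"

definition smooth_on :: "'b::real_normed_vector set \<Rightarrow> ('b \<Rightarrow> 'c::real_normed_vector) \<Rightarrow> bool" where
  "smooth_on U f \<longleftrightarrow> (\<forall>k. Ck_on k U f)"

definition partial_deriv :: "'n::finite \<Rightarrow> (real^'n \<Rightarrow> real) \<Rightarrow> real^'n \<Rightarrow> real" where
  "partial_deriv i u x = frechet_derivative u (at x) (axis i 1)"


section \<open>Submanifolds of Euclidean space with a Riemannian metric\<close>

text \<open>A manifold is a subset \<^term>\<open>M\<close> of the ambient space; its dimension is \<open>CARD('n)\<close>, and the
  type argument \<open>'n itself\<close> records it where no parametrization occurs in the arguments.\<close>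

definition local_param ::
    "(real^'d::finite) set \<Rightarrow> (real^'n::finite) set \<Rightarrow> (real^'n \<Rightarrow> real^'d) \<Rightarrow> bool" where
  "local_param M U \<phi> \<longleftrightarrow>
     open U \<and> smooth_on U \<phi> \<and> (\<forall>x\<in>U. inj (frechet_derivative \<phi> (at x))) \<and>
     openin (top_of_set M) (\<phi> ` U) \<and> (\<exists>\<xi>. homeomorphism U (\<phi> ` U) \<phi> \<xi>)"

definition smooth_submanifold :: "'n::finite itself \<Rightarrow> (real^'d::finite) set \<Rightarrow> bool" where
  "smooth_submanifold _ M \<longleftrightarrow>
     (\<forall>p\<in>M. \<exists>U (\<phi> :: real^'n \<Rightarrow> real^'d). local_param M U \<phi> \<and> p \<in> \<phi> ` U)"

definition smooth_fun_on_manifold ::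
    "'n::finite itself \<Rightarrow> (real^'d::finite) set \<Rightarrow> (real^'d \<Rightarrow> real) \<Rightarrow> bool" where
  "smooth_fun_on_manifold _ M f \<longleftrightarrow>
     (\<forall>U (\<phi> :: real^'n \<Rightarrow> real^'d). local_param M U \<phi> \<longrightarrow> smooth_on U (f \<circ> \<phi>))"

text \<open>A metric is given as \<open>g p u v\<close>, of which only the values with \<^term>\<open>p \<in> M\<close> and \<open>u\<close>, \<open>v\<close>
  tangent to \<^term>\<open>M\<close> at \<open>p\<close> matter.  The tangent space at \<open>\<phi> x\<close> is the range of the derivative of
  \<open>\<phi>\<close> at \<open>x\<close>.\<close>

definition pullback_metric ::
    "(real^'d::finite \<Rightarrow> real^'d \<Rightarrow> real^'d \<Rightarrow> real) \<Rightarrow> (real^'n::finite \<Rightarrow> real^'d)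
      \<Rightarrow> real^'n \<Rightarrow> real^'n \<Rightarrow> real^'n \<Rightarrow> real" where
  "pullback_metric g \<phi> x v w =
     g (\<phi> x) (frechet_derivative \<phi> (at x) v) (frechet_derivative \<phi> (at x) w)"

definition metric_matrix ::
    "(real^'d::finite \<Rightarrow> real^'d \<Rightarrow> real^'d \<Rightarrow> real) \<Rightarrow> (real^'n::finite \<Rightarrow> real^'d)
      \<Rightarrow> real^'n \<Rightarrow> real^'n^'n" where
  "metric_matrix g \<phi> x = (\<chi> i j. pullback_metric g \<phi> x (axis i 1) (axis j 1))"

text \<open>Since the derivative of \<open>\<phi>\<close> is injective, the first three conditions on the pullback say that
  \<open>g\<close> is an inner product on every tangent space; the last one says that it is smooth.\<close>

definition riemannian_metric ::
    "'n::finite itself \<Rightarrow> (real^'d::finite) set \<Rightarrow> (real^'d \<Rightarrow> real^'d \<Rightarrow> real^'d \<Rightarrow> real) \<Rightarrow> bool" where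
  "riemannian_metric _ M g \<longleftrightarrow>
     (\<forall>U (\<phi> :: real^'n \<Rightarrow> real^'d). local_param M U \<phi> \<longrightarrow>
        (\<forall>x\<in>U. bilinear (pullback_metric g \<phi> x) \<and>
               (\<forall>v w. pullback_metric g \<phi> x v w = pullback_metric g \<phi> x w v) \<and>
               (\<forall>v. v \<noteq> 0 \<longrightarrow> pullback_metric g \<phi> x v v > 0)) \<and>
        (\<forall>i j. smooth_on U (\<lambda>x. metric_matrix g \<phi> x $ i $ j)))"

definition compact_riemannian_manifold ::
    "'n::finite itself \<Rightarrow> (real^'d::finite) set \<Rightarrow> (real^'d \<Rightarrow> real^'d \<Rightarrow> real^'d \<Rightarrow> real) \<Rightarrow> bool" where
  "compact_riemannian_manifold N M g \<longleftrightarrow>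
     compact M \<and> smooth_submanifold N M \<and> riemannian_metric N M g"

text \<open>As countably many parametrizations cover \<^term>\<open>M\<close>, there is exactly one such \<open>\<mu>\<close>.\<close>

definition riemannian_volume ::
    "'n::finite itself \<Rightarrow> (real^'d::finite) set \<Rightarrow> (real^'d \<Rightarrow> real^'d \<Rightarrow> real^'d \<Rightarrow> real)
      \<Rightarrow> (real^'d) measure \<Rightarrow> bool" where
  "riemannian_volume _ M g \<mu> \<longleftrightarrow>
     sets \<mu> = sets (restrict_space borel M) \<and>
     (\<forall>U (\<phi> :: real^'n \<Rightarrow> real^'d). local_param M U \<phi> \<longrightarrow>
        (\<forall>A\<in>sets borel. A \<subseteq> U \<longrightarrow>
           emeasure \<mu> (\<phi> ` A) =
             (\<integral>\<^sup>+x\<in>A. ennreal (sqrt (det (metric_matrix g \<phi> x))) \<partial>lborel)))"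

definition local_laplacian ::
    "(real^'d::finite \<Rightarrow> real^'d \<Rightarrow> real^'d \<Rightarrow> real) \<Rightarrow> (real^'n::finite \<Rightarrow> real^'d)
      \<Rightarrow> (real^'n \<Rightarrow> real) \<Rightarrow> real^'n \<Rightarrow> real" where
  "local_laplacian g \<phi> u x =
     (\<Sum>i\<in>UNIV. partial_deriv i
        (\<lambda>y. sqrt (det (metric_matrix g \<phi> y)) *
             (\<Sum>j\<in>UNIV. matrix_inv (metric_matrix g \<phi> y) $ i $ j * partial_deriv j u y)) x)
     / sqrt (det (metric_matrix g \<phi> x))"

text \<open>For a smooth \<^term>\<open>f\<close> the value does not depend on the chosen parametrization around \<open>p\<close>.\<close>

definition laplace_beltrami ::
    "'n::finite itself \<Rightarrow> (real^'d::finite) set \<Rightarrow> (real^'d \<Rightarrow> real^'d \<Rightarrow> real^'d \<Rightarrow> real)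
      \<Rightarrow> (real^'d \<Rightarrow> real) \<Rightarrow> real^'d \<Rightarrow> real" where
  "laplace_beltrami _ M g f p =
     (let (U, \<phi>, x) = (SOME (U, \<phi> :: real^'n \<Rightarrow> real^'d, x). local_param M U \<phi> \<and> x \<in> U \<and> \<phi> x = p)
      in local_laplacian g \<phi> (f \<circ> \<phi>) x)"


section \<open>Square-integrable functions and the eigenbasis\<close>

text \<open>Elements of \<open>L\<^sup>2\<close> are represented by functions, not by their classes modulo null sets.\<close>

definition L2_space :: "'a measure \<Rightarrow> ('a \<Rightarrow> real) set" where
  "L2_space \<mu> = {f. f \<in> borel_measurable \<mu> \<and> integrable \<mu> (\<lambda>x. (f x)\<^sup>2)}"

definition L2_inner :: "'a measure \<Rightarrow> ('a \<Rightarrow> real) \<Rightarrow> ('a \<Rightarrow> real) \<Rightarrow> real" where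
  "L2_inner \<mu> f h = (\<integral>x. f x * h x \<partial>\<mu>)"

definition L2_norm :: "'a measure \<Rightarrow> ('a \<Rightarrow> real) \<Rightarrow> real" where
  "L2_norm \<mu> f = sqrt (\<integral>x. (f x)\<^sup>2 \<partial>\<mu>)"

definition L2_orthonormal_basis :: "'a measure \<Rightarrow> (nat \<Rightarrow> 'a \<Rightarrow> real) \<Rightarrow> bool" where
  "L2_orthonormal_basis \<mu> e \<longleftrightarrow>
     (\<forall>k. e k \<in> L2_space \<mu>) \<and>
     (\<forall>k l. L2_inner \<mu> (e k) (e l) = (if k = l then 1 else 0)) \<and>
     (\<forall>f\<in>L2_space \<mu>. \<forall>\<epsilon>>0. \<exists>N c. L2_norm \<mu> (\<lambda>x. f x - (\<Sum>k<N. c k * e k x)) < \<epsilon>)"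

text \<open>The eigenvalues are listed with multiplicity.\<close>

definition laplace_eigenbasis ::
    "'n::finite itself \<Rightarrow> (real^'d::finite) set \<Rightarrow> (real^'d \<Rightarrow> real^'d \<Rightarrow> real^'d \<Rightarrow> real)
      \<Rightarrow> (real^'d) measure \<Rightarrow> (nat \<Rightarrow> real) \<Rightarrow> (nat \<Rightarrow> real^'d \<Rightarrow> real) \<Rightarrow> bool" where
  "laplace_eigenbasis N M g \<mu> lam e \<longleftrightarrow>
     mono lam \<and>
     (\<forall>k. smooth_fun_on_manifold N M (e k) \<and>
          (\<forall>p\<in>M. - laplace_beltrami N M g (e k) p = lam k * e k p)) \<and>
     L2_orthonormal_basis \<mu> e"


section \<open>Wavelets and the scattering transform\<close>

definition fourier_coeff :: "'a measure \<Rightarrow> (nat \<Rightarrow> 'a \<Rightarrow> real) \<Rightarrow> ('a \<Rightarrow> real) \<Rightarrow> nat \<Rightarrow> real" where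
  "fourier_coeff \<mu> e f k = (\<integral>x. f x * e k x \<partial>\<mu>)"

definition wavelet_hat :: "(real \<Rightarrow> real) \<Rightarrow> (nat \<Rightarrow> real) \<Rightarrow> int \<Rightarrow> nat \<Rightarrow> real" where
  "wavelet_hat G lam j k =
     sqrt (\<bar>G (2 powi (j - 1) * lam k)\<bar>\<^sup>2 - \<bar>G (2 powi j * lam k)\<bar>\<^sup>2)"

text \<open>The series for \<open>f \<star> \<psi>\<^sub>j\<close> converges in \<open>L\<^sup>2\<close>, so its sum is determined up to a null set;
  some representative is chosen.\<close>

definition wavelet_conv ::
    "'a measure \<Rightarrow> (nat \<Rightarrow> real) \<Rightarrow> (nat \<Rightarrow> 'a \<Rightarrow> real) \<Rightarrow> (real \<Rightarrow> real)
      \<Rightarrow> ('a \<Rightarrow> real) \<Rightarrow> int \<Rightarrow> 'a \<Rightarrow> real" where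
  "wavelet_conv \<mu> lam e G f j =
     (SOME h. h \<in> L2_space \<mu> \<and>
        (\<lambda>N. L2_norm \<mu> (\<lambda>x. h x -
            (\<Sum>k<N. fourier_coeff \<mu> e f k * wavelet_hat G lam j k * e k x))) \<longlonglongrightarrow> 0)"

text \<open>The head of the list is the index that is applied first.\<close>

primrec scattering_U ::
    "'a measure \<Rightarrow> (nat \<Rightarrow> real) \<Rightarrow> (nat \<Rightarrow> 'a \<Rightarrow> real) \<Rightarrow> (real \<Rightarrow> real)
      \<Rightarrow> int list \<Rightarrow> ('a \<Rightarrow> real) \<Rightarrow> 'a \<Rightarrow> real" where
  "scattering_U \<mu> lam e G [] f = f"
| "scattering_U \<mu> lam e G (j # js) f =
     scattering_U \<mu> lam e G js (\<lambda>x. \<bar>wavelet_conv \<mu> lam e G f j x\<bar>)"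

definition scattering_S2 ::
    "'a measure \<Rightarrow> (nat \<Rightarrow> real) \<Rightarrow> (nat \<Rightarrow> 'a \<Rightarrow> real) \<Rightarrow> (real \<Rightarrow> real)
      \<Rightarrow> ('a \<Rightarrow> real) \<Rightarrow> int list \<Rightarrow> real" where
  "scattering_S2 \<mu> lam e G f js = L2_norm \<mu> (scattering_U \<mu> lam e G js f)"

text \<open>\<open>\<int>\<^sup>m\<close> is the set of integer lists of length \<open>m\<close>.\<close>

definition int_tuples :: "nat \<Rightarrow> int list set" where
  "int_tuples m = {js. length js = m}"

definition in_l2 :: "'b set \<Rightarrow> ('b \<Rightarrow> real) \<Rightarrow> bool" where
  "in_l2 I a \<longleftrightarrow> (\<lambda>i. \<bar>a i\<bar>\<^sup>2) summable_on I"

definition l2_norm :: "'b set \<Rightarrow> ('b \<Rightarrow> real) \<Rightarrow> real" where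
  "l2_norm I a = sqrt (\<Sum>\<^sub>\<infinity>i\<in>I. \<bar>a i\<bar>\<^sup>2)"

end

theory Submission
  imports Defs
begin

text \<open>The eigenvalues are nonnegative by the maximum principle: at an extremum of an eigenfunction
  the first order terms of the Laplacian vanish, and what remains is the trace of a positive
  semidefinite matrix times the Hessian.  Hence \<open>G\<close> is only evaluated on \<open>[0, \<infinity>)\<close>, and the squares
  of the wavelet multipliers telescope in the scale to a sum of at most \<open>C\<^sup>2\<close>.  With Bessel's
  inequality this makes one layer \<open>f \<mapsto> (\<bar>f \<star> \<psi>\<^sub>j\<bar>)\<^sub>j\<close> Lipschitz with constant \<open>C\<close>; composing \<open>m\<close>
  layers gives \<open>C\<^sup>m\<close>, and taking norms at the end is \<open>1\<close>-Lipschitz.\<close>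

section \<open>Nonnegativity of the eigenvalues\<close>

text \<open>The maximum principle stands in for Green's formula because it is local: one chart
  around one extremal point suffices, compactness supplies the point, and nothing is integrated over
  \<open>M\<close>. The analytic part has to cope with functions in place of classes.
  \<open>wavelet_conv\<close> chooses a representative, so nothing is known about it until the
  series is shown to have a limit, which is why completeness of the space is proved. The chosen
  representatives also need not depend linearly on \<open>f\<close> pointwise; the difference of two
  of them is therefore compared in norm with the partial sums for f - g, whose coefficients are
  linear. The modulus breaks linearity between layers, so every estimate is stated for a difference
  of two inputs. Scales and paths range over finite sets until the last step, which passes to all of
  Z^m.\<close>

lemma sum_insert_square:
  fixes F :: "'a \<Rightarrow> 'a \<Rightarrow> real"
  assumes "finite S" "s \<notin> S"
  shows "(\<Sum>i\<in>insert s S. \<Sum>j\<in>insert s S. F i j) =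
    F s s + (\<Sum>j\<in>S. F s j) + (\<Sum>i\<in>S. F i s) + (\<Sum>i\<in>S. \<Sum>j\<in>S. F i j)"
  using assms by (simp add: sum.distrib)

text \<open>Splitting off the rank one part \<open>a i s * a j s / a s s\<close> leaves the Schur complement, which is
  positive semidefinite on the smaller index set.\<close>

lemma sum_psd_times_nsd_nonpos:
  fixes a H :: "'a \<Rightarrow> 'a \<Rightarrow> real"
  assumes "finite S"
    and "\<And>i j. i \<in> S \<Longrightarrow> j \<in> S \<Longrightarrow> a i j = a j i"
    and "\<And>w. 0 \<le> (\<Sum>i\<in>S. \<Sum>j\<in>S. a i j * w i * w j)"
    and "\<And>w. (\<Sum>i\<in>S. \<Sum>j\<in>S. H i j * w i * w j) \<le> 0"
  shows "(\<Sum>i\<in>S. \<Sum>j\<in>S. a i j * H i j) \<le> 0"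
  using assms
proof (induction S arbitrary: a rule: finite_induct)
  case empty
  then show ?case by simp
next
  case (insert s S)
  note sq = sum_insert_square[OF insert.hyps(1,2)]
  have sym: "a s i = a i s" if "i \<in> S" for i using insert.prems(1)[of s i] that by simp
  define L where "L w = (\<Sum>i\<in>S. a i s * w i)" for w
  define Q where "Q w = (\<Sum>i\<in>S. \<Sum>j\<in>S. a i j * w i * w j)" for w
  have ext: "(\<Sum>i\<in>S. \<Sum>j\<in>S. F i j * (w(s:=t)) i * (w(s:=t)) j) = (\<Sum>i\<in>S. \<Sum>j\<in>S. F i j * w i * w j)"
    for F :: "'a \<Rightarrow> 'a \<Rightarrow> real" and w t
    using insert.hyps by (intro sum.cong refl) auto
  \<comment> \<open>The form of \<open>a\<close> at the vector \<open>w\<close> extended by the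
    entry \<open>t\<close> at \<open>s\<close>, read as a polynomial in \<open>t\<close>; both cases
    below pick a suitable \<open>t\<close>.\<close>
  have key: "0 \<le> a s s * t\<^sup>2 + 2 * t * L w + Q w" for t w
  proof -
    have "0 \<le> (\<Sum>i\<in>insert s S. \<Sum>j\<in>insert s S. a i j * (w(s:=t)) i * (w(s:=t)) j)"
      by (rule insert.prems)
    also have "\<dots> = a s s * t * t + (\<Sum>j\<in>S. a s j * t * w j) + (\<Sum>i\<in>S. a i s * w i * t) + Q w"
      unfolding sq ext Q_def using insert.hyps
      by (auto intro!: arg_cong2[where f="(+)"] sum.cong)
    also have "(\<Sum>j\<in>S. a s j * t * w j) = t * L w"
      unfolding L_def sum_distrib_left by (intro sum.cong) (auto simp: sym)
    also have "(\<Sum>i\<in>S. a i s * w i * t) = t * L w"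
      unfolding L_def sum_distrib_left by (intro sum.cong) auto
    finally show ?thesis by (simp add: power2_eq_square algebra_simps)
  qed
  have ass: "0 \<le> a s s" using key[of 1 "\<lambda>_. 0"] by (simp add: L_def Q_def)
  have HS: "(\<Sum>i\<in>S. \<Sum>j\<in>S. H i j * w i * w j) \<le> 0" for w
  proof -
    have "(\<Sum>i\<in>insert s S. \<Sum>j\<in>insert s S. H i j * (w(s:=0)) i * (w(s:=0)) j) \<le> 0"
      by (rule insert.prems)
    then show ?thesis unfolding sq ext by simp
  qed
  show ?case
  proof (cases "a s s = 0")
    case True
    have L0: "L w = 0" for w
    proof (rule ccontr)
      assume "L w \<noteq> 0"
      \<comment> \<open>With \<open>a s s = 0\<close> the polynomial is affine in \<open>t\<close>,
        and this \<open>t\<close> gives it the value -1.\<close>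
      then show False using key[of "-(Q w + 1) / (2 * L w)" w] True by (simp add: field_simps)
    qed
    have z: "a i s = 0" if "i \<in> S" for i
    proof -
      have "L (\<lambda>k. if k = i then 1 else 0) = a i s"
        using that insert.hyps by (simp add: L_def if_distrib[of "(*) _"] cong: if_cong)
      with L0 show ?thesis by simp
    qed
    have "(\<Sum>i\<in>S. \<Sum>j\<in>S. a i j * H i j) \<le> 0"
    proof (rule insert.IH)
      show "0 \<le> (\<Sum>i\<in>S. \<Sum>j\<in>S. a i j * w i * w j)" for w
        using key[of 0 w] by (simp add: Q_def)
    qed (use insert.prems(1) HS in auto)
    then show ?thesis unfolding sq by (simp add: True sym z)
  next
    case False
    with ass have pos: "0 < a s s" by simp
    define b where "b i j = a i j - a i s * a j s / a s s" for i j
    have "(\<Sum>i\<in>S. \<Sum>j\<in>S. b i j * H i j) \<le> 0"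
    proof (rule insert.IH)
      show "b i j = b j i" if "i \<in> S" "j \<in> S" for i j
        using insert.prems(1)[of i j] that by (simp add: b_def)
      show "0 \<le> (\<Sum>i\<in>S. \<Sum>j\<in>S. b i j * w i * w j)" for w
      proof -
        have "(\<Sum>i\<in>S. \<Sum>j\<in>S. b i j * w i * w j) = Q w - (L w)\<^sup>2 / a s s"
          unfolding b_def Q_def L_def power2_eq_square sum_product sum_divide_distrib
            sum_subtractf[symmetric]
          by (intro sum.cong refl) (simp add: algebra_simps)
        \<comment> \<open>The polynomial in \<open>key\<close> attains its minimum at
          \<open>t = - L w / a s s\<close>, and the minimum is the form of the Schur
          complement.\<close>
        also have "\<dots> = a s s * (- L w / a s s)\<^sup>2 + 2 * (- L w / a s s) * L w + Q w"
          using pos by (simp add: field_simps power2_eq_square)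
        finally show ?thesis using key[of "- L w / a s s" w] by linarith
      qed
    qed (use HS in auto)
    \<comment> \<open>Pairing the split-off rank one part with \<open>H\<close> evaluates the form
      of \<open>H\<close> at column \<open>s\<close> of \<open>a\<close>.\<close>
    moreover have "(\<Sum>i\<in>insert s S. \<Sum>j\<in>insert s S. H i j * a i s * a j s) \<le> 0"
      by (rule insert.prems(3))
    moreover have "(\<Sum>i\<in>insert s S. \<Sum>j\<in>insert s S. a i j * H i j) =
        (\<Sum>i\<in>insert s S. \<Sum>j\<in>insert s S. b i j * H i j) +
        (\<Sum>i\<in>insert s S. \<Sum>j\<in>insert s S. H i j * a i s * a j s) / a s s"
      unfolding b_def sum_divide_distrib sum.distrib[symmetric]
      by (intro sum.cong refl) (simp add: algebra_simps)
    \<comment> \<open>Row and column \<open>s\<close> of \<open>b\<close> vanish.\<close>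
    moreover have "(\<Sum>i\<in>insert s S. \<Sum>j\<in>insert s S. b i j * H i j) = (\<Sum>i\<in>S. \<Sum>j\<in>S. b i j * H i j)"
      unfolding sq using pos by (simp add: b_def sym)
    ultimately show ?thesis
      using pos by (smt (verit) divide_nonpos_pos)
  qed
qed

text \<open>If \<open>l\<close> were positive, \<open>r\<close> would be positive just to the right
  of its zero at 0, and the mean value theorem would yield a value of \<open>q\<close> above
  \<open>q 0\<close>.\<close>

lemma DERIV2_local_max_nonpos:
  fixes q r :: "real \<Rightarrow> real"
  assumes d: "0 < d"
    and q: "\<And>t. \<bar>t\<bar> < d \<Longrightarrow> DERIV q t :> r t"
    and r: "DERIV r 0 :> l"
    and max: "\<And>t. \<bar>t\<bar> < d \<Longrightarrow> q t \<le> q 0"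
  shows "l \<le> 0"
proof (rule ccontr)
  assume "\<not> l \<le> 0"
  then obtain h where h: "h > 0" "\<And>k. 0 < k \<Longrightarrow> k < h \<Longrightarrow> r 0 < r k"
    using DERIV_pos_inc_right[OF r] by auto
  have r0: "r 0 = 0" using DERIV_local_max[OF q d] max d by auto
  define t where "t = min h d / 2"
  have t: "0 < t" "t < h" "t < d" using h d by (auto simp: t_def min_def)
  obtain z where z: "0 < z" "z < t" "q t - q 0 = (t - 0) * r z"
    using MVT2[OF t(1), of q r] q t by force
  have "0 < r z" using h z t r0 by simp
  with z t have "q 0 < q t" by (smt (verit) mult_pos_pos)
  with max[of t] t show False by simp
qed

text \<open>Where \<open>p\<close> vanishes, the term of the product rule that differentiates
  \<open>c\<close> drops out, so continuity of \<open>c\<close> is enough. This lets the metric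
  coefficients in the Laplacian be treated as merely continuous.\<close>

lemma has_derivative_mult_zero:
  fixes p c :: "'a::real_normed_vector \<Rightarrow> real"
  assumes p: "(p has_derivative p') (at x)" and p0: "p x = 0" and c: "isCont c x"
  shows "((\<lambda>y. c y * p y) has_derivative (\<lambda>h. c x * p' h)) (at x)"
proof -
  have bl: "bounded_linear p'" using p by (rule has_derivative_bounded_linear)
  obtain K where K: "K > 0" "\<And>h. norm (p' h) \<le> norm h * K"
    using bounded_linear.pos_bounded[OF bl] by auto
  have "\<exists>d>0. \<forall>y. norm (y - x) < d \<longrightarrow>
      norm (c y * p y - c x * p x - c x * p' (y - x)) \<le> e * norm (y - x)" if e: "e > 0" for e
  proof -
    \<comment> \<open>Each error term gets half of \<open>e\<close>: \<open>e1\<close> allows for |c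
      y| <= |c x| + 1, guaranteed by the cap 1 in \<open>e2\<close>, and \<open>e2\<close> allows
      for the growth constant \<open>K\<close> of \<open>p'\<close>.\<close>
    define e1 where "e1 = e / (2 * (\<bar>c x\<bar> + 1))"
    define e2 where "e2 = min 1 (e / (2 * K))"
    have e12: "e1 > 0" "e2 > 0" using e K by (auto simp: e1_def e2_def intro!: divide_pos_pos)
    obtain d1 where d1: "d1 > 0" "\<And>y. norm (y - x) < d1 \<Longrightarrow> norm (p y - p x - p' (y - x)) \<le> e1 * norm (y - x)"
      using p e12 unfolding has_derivative_at_alt by blast
    obtain d2 where d2: "d2 > 0" "\<And>y. norm (y - x) < d2 \<Longrightarrow> \<bar>c y - c x\<bar> < e2"
      using c e12 unfolding continuous_at_eps_delta by (metis dist_norm real_norm_def)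
    show ?thesis
    proof (intro exI[of _ "min d1 d2"] conjI allI impI)
      fix y assume "norm (y - x) < min d1 d2"
      then have y: "norm (p y - p' (y - x)) \<le> e1 * norm (y - x)" "\<bar>c y - c x\<bar> < e2"
        using d1 d2 p0 by auto
      have "norm (c y * p y - c x * p x - c x * p' (y - x))
          = \<bar>c y * (p y - p' (y - x)) + (c y - c x) * p' (y - x)\<bar>"
        by (simp add: p0 algebra_simps)
      also have "\<dots> \<le> \<bar>c y\<bar> * \<bar>p y - p' (y - x)\<bar> + \<bar>c y - c x\<bar> * \<bar>p' (y - x)\<bar>"
        by (metis abs_mult abs_triangle_ineq)
      also have "\<dots> \<le> (\<bar>c x\<bar> + 1) * (e1 * norm (y - x)) + (e / (2 * K)) * (norm (y - x) * K)"
        using y K(2)[of "y - x"] K(1) e by (intro add_mono mult_mono) (auto simp: e2_def)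
      also have "\<dots> = e * norm (y - x)"
      proof -
        have "(\<bar>c x\<bar> + 1) * e1 = e / 2" unfolding e1_def by (simp add: field_simps add_nonneg_eq_0_iff)
        then have "(\<bar>c x\<bar> + 1) * (e1 * norm (y - x)) = e / 2 * norm (y - x)" by (metis mult.assoc)
        moreover have "(e / (2 * K)) * (norm (y - x) * K) = e / 2 * norm (y - x)" using K(1) by simp
        ultimately show ?thesis by (simp only: field_sum_of_halves distrib_right[symmetric])
      qed
      finally show "norm (c y * p y - c x * p x - c x * p' (y - x)) \<le> e * norm (y - x)" .
    qed (use d1 d2 in auto)
  qed
  moreover have "bounded_linear (\<lambda>h. c x * p' h)" using bl by (rule bounded_linear_const_mult)
  ultimately show ?thesis unfolding has_derivative_at_alt by blast
qed

section \<open>Inverse matrices: definiteness and continuity\<close>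

lemma matrix_inv_mult:
  fixes A :: "real^'n::finite^'n"
  assumes "invertible A"
  shows "A ** matrix_inv A = mat 1" "matrix_inv A ** A = mat 1"
  using assms someI_ex[of "\<lambda>B. A ** B = mat 1 \<and> B ** A = mat 1"]
  unfolding matrix_inv_def invertible_def by blast+

text \<open>With B the inverse and z = B v, the form of B at v is the form of A at z. Symmetry
  follows because the transpose of B is again a left inverse of A.\<close>

lemma matrix_inv_symmetric_psd:
  fixes A :: "real^'n::finite^'n"
  assumes sym: "transpose A = A" and pd: "\<And>z. z \<noteq> 0 \<Longrightarrow> 0 < (A *v z) \<bullet> z"
  shows "matrix_inv A $ i $ j = matrix_inv A $ j $ i"
    and "0 \<le> (\<Sum>i\<in>UNIV. \<Sum>j\<in>UNIV. matrix_inv A $ i $ j * w i * w j)"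
    and "det A \<noteq> 0"
proof -
  have "A *v z = 0 \<longrightarrow> z = 0" for z using pd[of z] by (cases "z = 0") auto
  then have inv: "invertible A"
    using matrix_left_invertible_ker invertible_left_inverse by blast
  then show "det A \<noteq> 0" using invertible_det_nz by blast
  define B where "B = matrix_inv A"
  have B: "A ** B = mat 1" "B ** A = mat 1" using inv unfolding B_def by (rule matrix_inv_mult)+
  have "transpose B ** A = mat 1" by (metis B(1) matrix_transpose_mul sym transpose_mat)
  then have "transpose B = B" by (metis B(1) matrix_mul_assoc matrix_mul_lid matrix_mul_rid)
  then show "matrix_inv A $ i $ j = matrix_inv A $ j $ i"
    unfolding B_def[symmetric] by (metis transpose_def vec_lambda_beta)
  define v where "v = (\<chi> i. w i)"
  have "(\<Sum>i\<in>UNIV. \<Sum>j\<in>UNIV. matrix_inv A $ i $ j * w i * w j) = v \<bullet> (B *v v)"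
    unfolding inner_vec_def matrix_vector_mult_def B_def[symmetric] v_def sum_distrib_left
    by (auto simp: sum_distrib_left algebra_simps intro!: sum.cong)
  also have "\<dots> = (A *v (B *v v)) \<bullet> (B *v v)"
    by (simp add: matrix_vector_mul_assoc B)
  also have "\<dots> \<ge> 0" using pd[of "B *v v"] by (cases "B *v v = 0") auto
  finally show "0 \<le> (\<Sum>i\<in>UNIV. \<Sum>j\<in>UNIV. matrix_inv A $ i $ j * w i * w j)" .
qed

lemma continuous_on_det:
  fixes A :: "'a::topological_space \<Rightarrow> real^'n::finite^'n"
  assumes "\<And>i j. continuous_on U (\<lambda>y. A y $ i $ j)"
  shows "continuous_on U (\<lambda>y. det (A y))"
  unfolding det_def by (intro continuous_intros assms)

text \<open>Cramer's rule writes each entry of the inverse as a quotient of two determinants, which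
  are polynomials in continuous entries.\<close>

lemma continuous_on_matrix_inv:
  fixes A :: "'a::topological_space \<Rightarrow> real^'n::finite^'n"
  assumes A: "\<And>i j. continuous_on U (\<lambda>y. A y $ i $ j)" and det: "\<And>y. y \<in> U \<Longrightarrow> det (A y) \<noteq> 0"
  shows "continuous_on U (\<lambda>y. matrix_inv (A y) $ i $ j)"
proof -
  have eq: "matrix_inv (A y) $ i $ j =
      det (\<chi> k l. if l = i then axis j 1 $ k else A y $ k $ l) / det (A y)" if "y \<in> U" for y
  proof -
    have "A y *v (matrix_inv (A y) *v axis j 1) = axis j 1"
      using det[OF that] by (simp add: matrix_vector_mul_assoc matrix_inv_mult invertible_det_nz)
    then have "matrix_inv (A y) *v axis j 1 =
        (\<chi> i. det (\<chi> k l. if l = i then axis j 1 $ k else A y $ k $ l) / det (A y))"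
      by (rule iffD1[OF cramer[OF det[OF that]]])
    then have "(matrix_inv (A y) *v axis j 1) $ i =
        det (\<chi> k l. if l = i then axis j 1 $ k else A y $ k $ l) / det (A y)"
      by (simp only: vec_lambda_beta)
    then show ?thesis by (simp only: matrix_vector_mult_basis column_def vec_lambda_beta)
  qed
  have ent: "continuous_on U (\<lambda>y. (\<chi> k l. if l = i then axis j 1 $ k else A y $ k $ l) $ k' $ l')" for k' l'
    using A by (cases "l' = i") auto
  have "continuous_on U (\<lambda>y. det (\<chi> k l. if l = i then axis j 1 $ k else A y $ k $ l) / det (A y))"
    using det by (intro continuous_on_divide continuous_on_det A ent) auto
  then show ?thesis using eq by (simp only: cong: continuous_on_cong)
qed

section \<open>The Laplacian at an extremum\<close>

lemma Ck_on_imp_continuous_on: "Ck_on k U f \<Longrightarrow> continuous_on U f"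
  by (cases k) (auto intro!: differentiable_imp_continuous_on
      simp: differentiable_on_def differentiable_at_withinI)

lemma smooth_on_imp_continuous_on: "smooth_on U f \<Longrightarrow> continuous_on U f"
  unfolding smooth_on_def using Ck_on_imp_continuous_on by blast

text \<open>The factor \<open>\<sigma>\<close> treats maxima and minima at once. In the divergence
  form the weight and the inverse metric multiply first derivatives that vanish at \<open>x\<close>,
  so only second derivatives of \<open>v\<close> survive, and the outer division cancels the
  weight.\<close>

lemma local_laplacian_sign_at_extremum:
  fixes v :: "real^'n::finite \<Rightarrow> real" and \<phi> :: "real^'n \<Rightarrow> real^'d::finite"
  assumes U: "open U" "x \<in> U" and sm: "smooth_on U v"
    and \<sigma>: "\<sigma> \<noteq> 0" and max: "\<And>y. y \<in> U \<Longrightarrow> \<sigma> * v y \<le> \<sigma> * v x"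
    and cont: "\<And>i j. continuous_on U (\<lambda>y. metric_matrix met \<phi> y $ i $ j)"
    and sym: "\<And>y. y \<in> U \<Longrightarrow> transpose (metric_matrix met \<phi> y) = metric_matrix met \<phi> y"
    and pd: "\<And>y z. y \<in> U \<Longrightarrow> z \<noteq> 0 \<Longrightarrow> 0 < (metric_matrix met \<phi> y *v z) \<bullet> z"
  shows "\<sigma> * local_laplacian met \<phi> v x \<le> 0"
proof -
  define A where "A = metric_matrix met \<phi>"
  define p where "p = (\<lambda>w y. frechet_derivative v (at y) w)"
  have C2: "Ck_on (Suc (Suc 0)) U v" using sm unfolding smooth_on_def by blast
  have v_der: "(v has_derivative (\<lambda>w. p w y)) (at y)" if "y \<in> U" for y
    using C2 that by (auto simp: p_def intro!: frechet_derivative_works[THEN iffD1])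
  have p_der: "(p w has_derivative frechet_derivative (p w) (at y)) (at y)" if "y \<in> U" for w y
    using C2 that by (auto simp: p_def intro!: frechet_derivative_works[THEN iffD1])
  have p0: "p w x = 0" for w
  proof -
    have "(\<lambda>w. \<sigma> * p w x) = (\<lambda>w. 0)"
      by (rule differential_zero_maxmin[OF U(2,1) has_derivative_mult_right[OF v_der[OF U(2)]]])
        (use max in auto)
    then show ?thesis using \<sigma> by (metis mult_eq_0_iff)
  qed
  define H where "H i j = frechet_derivative (p (axis j 1)) (at x) (axis i 1)" for i j :: 'n
  \<comment> \<open>On the line through \<open>x\<close> with direction \<open>z\<close> the second
    derivative of \<open>v\<close> is the form of the Hessian at \<open>w\<close>, so the
    one-variable test applies.\<close>
  have H: "(\<Sum>i\<in>UNIV. \<Sum>j\<in>UNIV. (\<sigma> * H i j) * w i * w j) \<le> 0" for w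
  proof -
    define z :: "real^'n" where "z = (\<chi> i. w i)"
    have z: "z = (\<Sum>i\<in>UNIV. w i *\<^sub>R axis i 1)"
      using basis_expansion[of z] by (simp add: z_def scalar_mult_eq_scaleR)
    have lin: "linear (frechet_derivative (p u) (at x))" for u
      using p_der[OF U(2)] has_derivative_linear by blast
    have p_z: "p z y = (\<Sum>j\<in>UNIV. w j * p (axis j 1) y)" if "y \<in> U" for y
    proof -
      have l: "linear (\<lambda>u. p u y)" using v_der[OF that] by (rule has_derivative_linear)
      show ?thesis unfolding z by (simp add: linear_sum[OF l] linear_scale[OF l])
    qed
    have "((\<lambda>y. \<Sum>j\<in>UNIV. w j * p (axis j 1) y) has_derivative
        (\<lambda>h. \<Sum>j\<in>UNIV. w j * frechet_derivative (p (axis j 1)) (at x) h)) (at x)"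
      by (intro derivative_intros p_der U)
    then have "(p z has_derivative
        (\<lambda>h. \<Sum>j\<in>UNIV. w j * frechet_derivative (p (axis j 1)) (at x) h)) (at x)"
      by (rule has_derivative_transform_within_open[OF _ U]) (simp add: p_z)
    moreover have "(\<Sum>j\<in>UNIV. w j * frechet_derivative (p (axis j 1)) (at x) z)
        = (\<Sum>i\<in>UNIV. \<Sum>j\<in>UNIV. H i j * w i * w j)"
    proof -
      have exp: "frechet_derivative (p u) (at x) z =
          (\<Sum>i\<in>UNIV. w i * frechet_derivative (p u) (at x) (axis i 1))" for u
        unfolding z by (simp add: linear_sum[OF lin] linear_scale[OF lin])
      have "(\<Sum>j\<in>UNIV. w j * frechet_derivative (p (axis j 1)) (at x) z) =
          (\<Sum>j\<in>UNIV. \<Sum>i\<in>UNIV. H i j * w i * w j)"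
        unfolding exp H_def sum_distrib_left by (intro sum.cong refl) simp
      also have "\<dots> = (\<Sum>i\<in>UNIV. \<Sum>j\<in>UNIV. H i j * w i * w j)" by (rule sum.swap)
      finally show ?thesis .
    qed
    ultimately obtain P where P: "(p z has_derivative P) (at x)"
      "P z = (\<Sum>i\<in>UNIV. \<Sum>j\<in>UNIV. H i j * w i * w j)" by blast
    have line: "((\<lambda>t. x + t *\<^sub>R z) has_derivative (\<lambda>t. t *\<^sub>R z)) (at t)" for t
      by (auto intro!: derivative_eq_intros)
    obtain r where r: "r > 0" "ball x r \<subseteq> U" using U open_contains_ball by blast
    \<comment> \<open>Keeps x + t z inside the ball for |t| < d; the added 1 covers
      \<open>z = 0\<close>.\<close>
    define d where "d = r / (norm z + 1)"
    have d: "d > 0" using r by (auto simp: d_def add_nonneg_pos)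
    have in_U: "x + t *\<^sub>R z \<in> U" if "\<bar>t\<bar> < d" for t
    proof -
      have "\<bar>t\<bar> * norm z \<le> \<bar>t\<bar> * (norm z + 1)" by (simp add: mult_left_mono)
      also have "\<dots> < d * (norm z + 1)" using that by (intro mult_strict_right_mono) (auto simp: add_nonneg_pos)
      also have "\<dots> = r" by (simp add: d_def add_nonneg_eq_0_iff)
      finally have "x + t *\<^sub>R z \<in> ball x r" by (simp add: dist_norm)
      then show ?thesis using r by blast
    qed
    have "\<sigma> * P z \<le> 0"
    proof (rule DERIV2_local_max_nonpos[OF d, of "\<lambda>t. \<sigma> * v (x + t *\<^sub>R z)" "\<lambda>t. \<sigma> * p z (x + t *\<^sub>R z)"])
      show "((\<lambda>t. \<sigma> * v (x + t *\<^sub>R z)) has_real_derivative \<sigma> * p z (x + t *\<^sub>R z)) (at t)" if "\<bar>t\<bar> < d" for t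
        using has_derivative_compose[OF line v_der[OF in_U[OF that]]]
          linear_scale[OF has_derivative_linear[OF v_der[OF in_U[OF that]]]]
        by (intro DERIV_cmult) (simp add: has_field_derivative_def mult_commute_abs)
      have P0: "(p z has_derivative P) (at (x + 0 *\<^sub>R z))" using P by simp
      show "((\<lambda>t. \<sigma> * p z (x + t *\<^sub>R z)) has_real_derivative \<sigma> * P z) (at 0)"
        using has_derivative_compose[OF line P0] linear_scale[OF has_derivative_linear[OF P(1)]]
        by (intro DERIV_cmult) (simp add: has_field_derivative_def mult_commute_abs)
      show "\<sigma> * v (x + t *\<^sub>R z) \<le> \<sigma> * v (x + 0 *\<^sub>R z)" if "\<bar>t\<bar> < d" for t
        using max[OF in_U[OF that]] by simp
    qed
    then show ?thesis by (simp add: P(2) sum_distrib_left mult.assoc)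
  qed
  have det: "det (A y) \<noteq> 0" if "y \<in> U" for y
    using matrix_inv_symmetric_psd(3)[OF sym pd] that unfolding A_def by blast
  define s where "s = sqrt (det (A x))"
  have s: "s \<noteq> 0" using det U by (simp add: s_def)
  have coeff: "isCont (\<lambda>y. sqrt (det (A y)) * matrix_inv (A y) $ i $ j) x" for i j
  proof -
    have "continuous_on U (\<lambda>y. sqrt (det (A y)) * matrix_inv (A y) $ i $ j)"
      by (intro continuous_on_mult continuous_on_real_sqrt continuous_on_det continuous_on_matrix_inv)
        (use cont det in \<open>auto simp: A_def\<close>)
    then show ?thesis using U continuous_on_eq_continuous_at by blast
  qed
  have flux: "partial_deriv i (\<lambda>y. sqrt (det (A y)) *
      (\<Sum>j\<in>UNIV. matrix_inv (A y) $ i $ j * partial_deriv j v y)) x =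
      s * (\<Sum>j\<in>UNIV. matrix_inv (A x) $ i $ j * H i j)" for i
  proof -
    have "((\<lambda>y. \<Sum>j\<in>UNIV. (sqrt (det (A y)) * matrix_inv (A y) $ i $ j) * p (axis j 1) y)
        has_derivative (\<lambda>h. \<Sum>j\<in>UNIV. (sqrt (det (A x)) * matrix_inv (A x) $ i $ j) *
          frechet_derivative (p (axis j 1)) (at x) h)) (at x)"
      by (intro has_derivative_sum has_derivative_mult_zero p_der U p0 coeff)
    also have "(\<lambda>y. \<Sum>j\<in>UNIV. (sqrt (det (A y)) * matrix_inv (A y) $ i $ j) * p (axis j 1) y) =
        (\<lambda>y. sqrt (det (A y)) * (\<Sum>j\<in>UNIV. matrix_inv (A y) $ i $ j * partial_deriv j v y))"
      by (simp add: sum_distrib_left partial_deriv_def p_def mult.assoc)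
    finally show ?thesis
      unfolding partial_deriv_def
      by (subst frechet_derivative_at[symmetric], assumption)
        (simp add: H_def s_def sum_distrib_left mult.assoc)
  qed
  have "local_laplacian met \<phi> v x = (\<Sum>i\<in>UNIV. \<Sum>j\<in>UNIV. matrix_inv (A x) $ i $ j * H i j)"
    unfolding local_laplacian_def A_def[symmetric] flux s_def[symmetric] sum_distrib_left[symmetric]
    using s by simp
  \<comment> \<open>\<open>\<sigma>\<close> is attached to the Hessian, where it produces a negative
    semidefinite form.\<close>
  then have "\<sigma> * local_laplacian met \<phi> v x =
      (\<Sum>i\<in>UNIV. \<Sum>j\<in>UNIV. matrix_inv (A x) $ i $ j * (\<sigma> * H i j))"
    by (simp add: sum_distrib_left mult.left_commute)
  also have "\<dots> \<le> 0"
  proof (rule sum_psd_times_nsd_nonpos)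
    show "matrix_inv (A x) $ i $ j = matrix_inv (A x) $ j $ i" for i j
      unfolding A_def using matrix_inv_symmetric_psd(1)[OF sym pd] U by blast
    show "0 \<le> (\<Sum>i\<in>UNIV. \<Sum>j\<in>UNIV. matrix_inv (A x) $ i $ j * w i * w j)" for w
      unfolding A_def using matrix_inv_symmetric_psd(2)[OF sym pd] U by blast
  qed (use H in auto)
  finally show ?thesis .
qed

text \<open>Carries positivity of the metric on tangent vectors over to its coordinate
  matrix.\<close>

lemma metric_matrix_quadratic_form:
  fixes \<phi> :: "real^'n::finite \<Rightarrow> real^'d::finite"
  assumes "bilinear (pullback_metric met \<phi> x)"
  shows "(metric_matrix met \<phi> x *v z) \<bullet> z = pullback_metric met \<phi> x z z"
proof -
  have lin: "linear (pullback_metric met \<phi> x u)" "linear (\<lambda>u. pullback_metric met \<phi> x u y)" for u y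
    using assms unfolding bilinear_def by auto
  have "pullback_metric met \<phi> x z z =
      pullback_metric met \<phi> x (\<Sum>i\<in>UNIV. z $ i *\<^sub>R axis i 1) (\<Sum>i\<in>UNIV. z $ i *\<^sub>R axis i 1)"
    using basis_expansion[of z] by (simp add: scalar_mult_eq_scaleR)
  also have "\<dots> = (\<Sum>i\<in>UNIV. \<Sum>j\<in>UNIV. z $ i * (z $ j * pullback_metric met \<phi> x (axis i 1) (axis j 1)))"
    unfolding linear_sum[OF lin(1)] linear_sum[OF lin(2)] linear_scale[OF lin(1)]
        linear_scale[OF lin(2)]
    by (subst sum.swap) (simp add: sum_distrib_left mult.left_commute)
  also have "\<dots> = (metric_matrix met \<phi> x *v z) \<bullet> z"
    unfolding inner_vec_def matrix_vector_mult_def metric_matrix_def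
    by (simp add: sum_distrib_right sum_distrib_left algebra_simps)
  finally show ?thesis ..
qed

lemma laplace_beltrami_sign_at_extremum:
  fixes M :: "(real^'d::finite) set"
  assumes man: "compact_riemannian_manifold TYPE('n::finite) M met"
    and u: "smooth_fun_on_manifold TYPE('n) M u"
    and p: "p \<in> M" and \<sigma>: "\<sigma> \<noteq> 0" and max: "\<And>q. q \<in> M \<Longrightarrow> \<sigma> * u q \<le> \<sigma> * u p"
  shows "\<sigma> * laplace_beltrami TYPE('n) M met u p \<le> 0"
proof -
  \<comment> \<open>The very chart chosen inside \<open>laplace_beltrami\<close>; the sign estimate
    holds in any chart around \<open>p\<close>.\<close>
  define ch where "ch = (SOME (U, \<phi> :: real^'n \<Rightarrow> real^'d, x). local_param M U \<phi> \<and> x \<in> U \<and> \<phi> x = p)"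
  obtain U \<phi> x where ch_eq: "ch = (U, \<phi>, x)" by (cases ch)
  have "\<exists>ch. case ch of (U, \<phi> :: real^'n \<Rightarrow> real^'d, x) \<Rightarrow> local_param M U \<phi> \<and> x \<in> U \<and> \<phi> x = p"
    using man p unfolding compact_riemannian_manifold_def smooth_submanifold_def by fast
  then have "case ch of (U, \<phi> :: real^'n \<Rightarrow> real^'d, x) \<Rightarrow> local_param M U \<phi> \<and> x \<in> U \<and> \<phi> x = p"
    unfolding ch_def by (rule someI_ex)
  then have lp: "local_param M U \<phi>" and x: "x \<in> U" "\<phi> x = p" by (auto simp: ch_eq)
  have met: "bilinear (pullback_metric met \<phi> y)"
      "pullback_metric met \<phi> y v w = pullback_metric met \<phi> y w v"
      "v \<noteq> 0 \<Longrightarrow> pullback_metric met \<phi> y v v > 0" if "y \<in> U" for y v w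
    using man lp that unfolding compact_riemannian_manifold_def riemannian_metric_def by blast+
  have sm: "smooth_on U (\<lambda>x. metric_matrix met \<phi> x $ i $ j)" for i j
    using man lp unfolding compact_riemannian_manifold_def riemannian_metric_def by blast
  have in_M: "\<phi> y \<in> M" if "y \<in> U" for y
    using lp that openin_imp_subset unfolding local_param_def by fastforce
  have "\<sigma> * local_laplacian met \<phi> (u \<circ> \<phi>) x \<le> 0"
  proof (rule local_laplacian_sign_at_extremum)
    show "smooth_on U (u \<circ> \<phi>)" using u lp unfolding smooth_fun_on_manifold_def by blast
    show "transpose (metric_matrix met \<phi> y) = metric_matrix met \<phi> y" if "y \<in> U" for y
      using met(2)[OF that] by (simp add: transpose_def metric_matrix_def vec_eq_iff)
    show "0 < (metric_matrix met \<phi> y *v z) \<bullet> z" if "y \<in> U" "z \<noteq> 0" for y z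
      using met(1,3) that by (simp add: metric_matrix_quadratic_form)
    show "continuous_on U (\<lambda>y. metric_matrix met \<phi> y $ i $ j)" for i j
      using sm by (rule smooth_on_imp_continuous_on)
    show "\<sigma> * (u \<circ> \<phi>) y \<le> \<sigma> * (u \<circ> \<phi>) x" if "y \<in> U" for y
      using max in_M that x by simp
    show "open U" using lp unfolding local_param_def by blast
  qed (use x \<sigma> in auto)
  then show ?thesis
    unfolding laplace_beltrami_def ch_def[symmetric] ch_eq by simp
qed

text \<open>Smoothness is phrased through charts, while attaining a maximum asks for continuity on
  \<open>M\<close>. On a chart image \<open>u\<close> is \<open>u \<circ> \<phi>\<close> after the
  inverse chart, and as the image is open in \<open>M\<close>, limits within it are limits within
  \<open>M\<close>.\<close>

lemma smooth_fun_on_manifold_imp_continuous_on: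
  fixes M :: "(real^'d::finite) set"
  assumes M: "smooth_submanifold TYPE('n::finite) M"
    and u: "smooth_fun_on_manifold TYPE('n) M u"
  shows "continuous_on M u"
  unfolding continuous_on_eq_continuous_within
proof
  fix p assume "p \<in> M"
  then obtain U and \<phi> :: "real^'n \<Rightarrow> real^'d" where lp: "local_param M U \<phi>" and p: "p \<in> \<phi> ` U"
    using M unfolding smooth_submanifold_def by blast
  obtain \<xi> where hom: "homeomorphism U (\<phi> ` U) \<phi> \<xi>" using lp unfolding local_param_def by blast
  have "continuous_on U (u \<circ> \<phi>)"
    using u lp smooth_on_imp_continuous_on unfolding smooth_fun_on_manifold_def by blast
  then have "continuous_on (\<phi> ` U) ((u \<circ> \<phi>) \<circ> \<xi>)"
    using hom unfolding homeomorphism_def by (metis continuous_on_compose)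
  then have "continuous_on (\<phi> ` U) u"
    by (rule continuous_on_eq) (use homeomorphism_apply1[OF hom] in auto)
  then have "continuous (at p within \<phi> ` U) u"
    using p continuous_on_eq_continuous_within by blast
  moreover have "at p within \<phi> ` U = at p within M"
  proof -
    obtain T where "open T" "\<phi> ` U = M \<inter> T"
      using lp unfolding local_param_def openin_open by blast
    then show ?thesis using p by (intro at_within_nhd[of p T]) auto
  qed
  ultimately show "continuous (at p within M) u" by simp
qed

text \<open>At a positive maximum of an eigenfunction for a negative eigenvalue the Laplacian would be
  positive; with \<open>\<sigma> = -1\<close> the same applies at a negative minimum.\<close>

lemma eigenvalue_nonneg:
  fixes M :: "(real^'d::finite) set"
  assumes man: "compact_riemannian_manifold TYPE('n::finite) M met"
    and u: "smooth_fun_on_manifold TYPE('n) M u"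
    and eig: "\<And>p. p \<in> M \<Longrightarrow> - laplace_beltrami TYPE('n) M met u p = c * u p"
    and nz: "q \<in> M" "u q \<noteq> 0"
  shows "0 \<le> c"
proof (rule ccontr)
  assume c: "\<not> 0 \<le> c"
  define \<sigma> where "\<sigma> = sgn (u q)"
  have \<sigma>: "\<sigma> \<noteq> 0" "\<sigma> * u q > 0" using nz by (auto simp: \<sigma>_def sgn_if)
  have "compact M" "continuous_on M (\<lambda>p. \<sigma> * u p)" "M \<noteq> {}"
    using man u nz smooth_fun_on_manifold_imp_continuous_on
    unfolding compact_riemannian_manifold_def by (auto intro!: continuous_intros)
  then obtain p where p: "p \<in> M" "\<And>q. q \<in> M \<Longrightarrow> \<sigma> * u q \<le> \<sigma> * u p"
    using continuous_attains_sup by metis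
  with \<sigma> nz have "\<sigma> * u p > 0" by force
  with c have "c * (\<sigma> * u p) < 0" by (simp add: mult_neg_pos)
  moreover have "\<sigma> * laplace_beltrami TYPE('n) M met u p = - c * (\<sigma> * u p)"
    using eig[OF p(1)] by (simp add: minus_equation_iff algebra_simps)
  ultimately show False using laplace_beltrami_sign_at_extremum[OF man u p(1) \<sigma>(1) p(2)] by simp
qed

section \<open>Square-integrable functions\<close>

lemma L2_space_measurable [measurable_dest]: "f \<in> L2_space \<mu> \<Longrightarrow> f \<in> borel_measurable \<mu>"
  by (simp add: L2_space_def)

lemma L2_space_integrable_power2: "f \<in> L2_space \<mu> \<Longrightarrow> integrable \<mu> (\<lambda>x. (f x)\<^sup>2)"
  by (simp add: L2_space_def)

lemma L2_space_integrable_mult: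
  assumes f: "f \<in> L2_space \<mu>" and h: "h \<in> L2_space \<mu>"
  shows "integrable \<mu> (\<lambda>x. f x * h x)"
proof (rule Bochner_Integration.integrable_bound)
  show "integrable \<mu> (\<lambda>x. (f x)\<^sup>2 + (h x)\<^sup>2)"
    using f h by (intro Bochner_Integration.integrable_add L2_space_integrable_power2)
  show "(\<lambda>x. f x * h x) \<in> borel_measurable \<mu>"
    using f h by (intro borel_measurable_times L2_space_measurable)
  have "\<bar>a * b\<bar> \<le> a\<^sup>2 + b\<^sup>2" for a b :: real
    using sum_squares_bound[of "\<bar>a\<bar>" "\<bar>b\<bar>"] abs_ge_zero[of "a * b"] unfolding power2_abs abs_mult by linarith
  then show "AE x in \<mu>. norm (f x * h x) \<le> norm ((f x)\<^sup>2 + (h x)\<^sup>2)" by simp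
qed

lemma L2_space_lincomb:
  assumes f: "f \<in> L2_space \<mu>" and h: "h \<in> L2_space \<mu>"
  shows "(\<lambda>x. a * f x + b * h x) \<in> L2_space \<mu>"
proof -
  have "integrable \<mu> (\<lambda>x. a\<^sup>2 * (f x)\<^sup>2 + (2 * a * b) * (f x * h x) + b\<^sup>2 * (h x)\<^sup>2)"
    using f h by (intro Bochner_Integration.integrable_add integrable_mult_right
        L2_space_integrable_mult L2_space_integrable_power2)
  moreover have "a\<^sup>2 * (f x)\<^sup>2 + (2 * a * b) * (f x * h x) + b\<^sup>2 * (h x)\<^sup>2 = (a * f x + b * h x)\<^sup>2" for x
    by (simp add: power2_eq_square algebra_simps)
  ultimately show ?thesis
    using f h unfolding L2_space_def by auto
qed

lemma L2_space_add: "f \<in> L2_space \<mu> \<Longrightarrow> h \<in> L2_space \<mu> \<Longrightarrow> (\<lambda>x. f x + h x) \<in> L2_space \<mu>"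
  using L2_space_lincomb[of f \<mu> h 1 1] by simp

lemma L2_space_diff: "f \<in> L2_space \<mu> \<Longrightarrow> h \<in> L2_space \<mu> \<Longrightarrow> (\<lambda>x. f x - h x) \<in> L2_space \<mu>"
  using L2_space_lincomb[of f \<mu> h 1 "-1"] by simp

lemma L2_space_scale: "f \<in> L2_space \<mu> \<Longrightarrow> (\<lambda>x. c * f x) \<in> L2_space \<mu>"
  using L2_space_lincomb[of f \<mu> f c 0] by simp

lemma L2_space_abs: "f \<in> L2_space \<mu> \<Longrightarrow> (\<lambda>x. \<bar>f x\<bar>) \<in> L2_space \<mu>"
  unfolding L2_space_def by auto

lemma L2_space_sum:
  "(\<And>k. k \<in> F \<Longrightarrow> f k \<in> L2_space \<mu>) \<Longrightarrow> (\<lambda>x. \<Sum>k\<in>F. f k x) \<in> L2_space \<mu>"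
proof (induction F rule: infinite_finite_induct)
  case (insert k F)
  then show ?case using L2_space_add[of "f k" \<mu> "\<lambda>x. \<Sum>k\<in>F. f k x"] by simp
qed (simp_all add: L2_space_def)

lemma L2_norm_power2: "(L2_norm \<mu> f)\<^sup>2 = (\<integral>x. (f x)\<^sup>2 \<partial>\<mu>)"
  by (simp add: L2_norm_def)

lemma L2_norm_nonneg [simp]: "0 \<le> L2_norm \<mu> f"
  by (simp add: L2_norm_def)

lemma L2_norm_minus_commute: "L2_norm \<mu> (\<lambda>x. f x - h x) = L2_norm \<mu> (\<lambda>x. h x - f x)"
  by (simp add: L2_norm_def power2_commute)

lemma L2_norm_lincomb_power2:
  assumes f: "f \<in> L2_space \<mu>" and h: "h \<in> L2_space \<mu>"
  shows "(L2_norm \<mu> (\<lambda>x. a * f x + b * h x))\<^sup>2 =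
    a\<^sup>2 * (L2_norm \<mu> f)\<^sup>2 + 2 * a * b * L2_inner \<mu> f h + b\<^sup>2 * (L2_norm \<mu> h)\<^sup>2"
proof -
  have "(\<integral>x. (a * f x + b * h x)\<^sup>2 \<partial>\<mu>) =
      (\<integral>x. a\<^sup>2 * (f x)\<^sup>2 + (2 * a * b) * (f x * h x) + b\<^sup>2 * (h x)\<^sup>2 \<partial>\<mu>)"
    by (simp add: power2_eq_square algebra_simps)
  also have "\<dots> = a\<^sup>2 * (\<integral>x. (f x)\<^sup>2 \<partial>\<mu>) + (2 * a * b) * (\<integral>x. f x * h x \<partial>\<mu>) + b\<^sup>2 * (\<integral>x. (h x)\<^sup>2 \<partial>\<mu>)"
    using f h by (simp add: L2_space_integrable_mult L2_space_integrable_power2)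
  finally show ?thesis by (simp add: L2_norm_power2 L2_inner_def)
qed

text \<open>Cauchy-Schwarz from a nonnegative quadratic form in the coefficients. A function of norm
  zero need not vanish, hence the separate case \<open>A = 0\<close>.\<close>

lemma L2_inner_le_norm:
  assumes f: "f \<in> L2_space \<mu>" and h: "h \<in> L2_space \<mu>"
  shows "L2_inner \<mu> f h \<le> L2_norm \<mu> f * L2_norm \<mu> h"
proof -
  define A B I where "A = L2_norm \<mu> f" "B = L2_norm \<mu> h" "I = L2_inner \<mu> f h"
  have AB: "0 \<le> A" "0 \<le> B" by (auto simp: A_B_I_def)
  have q: "0 \<le> a\<^sup>2 * A\<^sup>2 + 2 * a * b * I + b\<^sup>2 * B\<^sup>2" for a b
    using L2_norm_lincomb_power2[OF f h, of a b] by (metis A_B_I_def zero_le_power2)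
  have "I\<^sup>2 \<le> (A * B)\<^sup>2"
  proof (cases "A = 0")
    case True
    have "I = 0"
    proof (rule ccontr)
      assume "I \<noteq> 0"
      \<comment> \<open>For \<open>A = 0\<close> these coefficients give the form the value
        -1.\<close>
      then show False using q[of "- (B\<^sup>2 + 1) / (2 * I)" 1] True by (simp add: field_simps)
    qed
    then show ?thesis by simp
  next
    case False
    then have "0 < A\<^sup>2" by simp
    moreover have "0 \<le> A\<^sup>2 * ((A * B)\<^sup>2 - I\<^sup>2)"
      using q[of "- I" "A\<^sup>2"] by (simp add: power2_eq_square algebra_simps)
    ultimately show ?thesis by (simp add: zero_le_mult_iff)
  qed
  then show ?thesis using AB unfolding A_B_I_def by (simp add: abs_le_square_iff[symmetric])
qed

lemma L2_norm_triangle: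
  assumes f: "f \<in> L2_space \<mu>" and h: "h \<in> L2_space \<mu>"
  shows "L2_norm \<mu> (\<lambda>x. f x + h x) \<le> L2_norm \<mu> f + L2_norm \<mu> h"
proof (rule power2_le_imp_le)
  show "(L2_norm \<mu> (\<lambda>x. f x + h x))\<^sup>2 \<le> (L2_norm \<mu> f + L2_norm \<mu> h)\<^sup>2"
    using L2_norm_lincomb_power2[OF f h, of 1 1] L2_inner_le_norm[OF f h]
    by (simp add: power2_sum)
qed simp

lemma L2_norm_reverse_triangle:
  assumes f: "f \<in> L2_space \<mu>" and h: "h \<in> L2_space \<mu>"
  shows "\<bar>L2_norm \<mu> f - L2_norm \<mu> h\<bar> \<le> L2_norm \<mu> (\<lambda>x. f x - h x)"
  using L2_norm_triangle[OF L2_space_diff[OF f h] h] L2_norm_triangle[OF L2_space_diff[OF h f] f]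
    L2_norm_minus_commute[of \<mu> f h]
  by (simp add: abs_le_iff)

text \<open>Riesz--Fischer: along a subsequence with \<open>\<parallel>D\<^sub>k\<parallel>\<^sup>2 \<le> 4\<^sup>-\<^sup>k\<close> for the consecutive differences
  \<open>D\<^sub>k\<close>, the bound \<open>\<bar>D\<^sub>k\<bar> \<le> 2\<^sup>-\<^sup>k + 2\<^sup>k D\<^sub>k\<^sup>2\<close> gives almost everywhere convergence, and Fatou's
  lemma turns it into convergence of the whole sequence in \<open>L\<^sup>2\<close>.\<close>

lemma L2_space_complete:
  fixes s :: "nat \<Rightarrow> 'a \<Rightarrow> real"
  assumes s: "\<And>n. s n \<in> L2_space \<mu>"
    and cauchy: "\<And>\<epsilon>. \<epsilon> > 0 \<Longrightarrow> \<exists>N. \<forall>m\<ge>N. \<forall>n\<ge>N. (L2_norm \<mu> (\<lambda>x. s m x - s n x))\<^sup>2 \<le> \<epsilon>"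
  shows "\<exists>h\<in>L2_space \<mu>. (\<lambda>n. L2_norm \<mu> (\<lambda>x. h x - s n x)) \<longlonglongrightarrow> 0"
proof -
  note [measurable] = s[THEN L2_space_measurable]
  have "\<forall>k. \<exists>N. \<forall>m\<ge>N. \<forall>n\<ge>N. (L2_norm \<mu> (\<lambda>x. s m x - s n x))\<^sup>2 \<le> (1/4)^k"
    by (intro allI cauchy) simp
  then obtain N where N: "\<And>k m n. m \<ge> N k \<Longrightarrow> n \<ge> N k \<Longrightarrow> (L2_norm \<mu> (\<lambda>x. s m x - s n x))\<^sup>2 \<le> (1/4)^k"
    by metis
  \<comment> \<open>The sum dominates all of \<open>N 0\<close>, ..., \<open>N k\<close> at once,
    whether or not \<open>N\<close> is monotone.\<close>
  define r where "r k = k + (\<Sum>i\<le>k. N i)" for k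
  have r_N: "N k \<le> r i" if "k \<le> i" for k i
  proof -
    have "N k \<le> (\<Sum>i\<le>i. N i)" using that by (intro member_le_sum) auto
    then show ?thesis by (simp add: r_def)
  qed
  have nn_norm: "(\<integral>\<^sup>+x. ennreal ((s m x - s n x)\<^sup>2) \<partial>\<mu>) = ennreal ((L2_norm \<mu> (\<lambda>x. s m x - s n x))\<^sup>2)" for m n
    unfolding L2_norm_power2
    by (intro nn_integral_eq_integral L2_space_integrable_power2 L2_space_diff s) simp
  define D where "D k x = s (r (Suc k)) x - s (r k) x" for k x
  have [measurable]: "D k \<in> borel_measurable \<mu>" for k unfolding D_def by measurable
  \<comment> \<open>The weight 2^k against squared norms of at most 4^-k leaves the summable
    2^-k.\<close>
  have "(\<integral>\<^sup>+x. (\<Sum>k. ennreal (2^k * (D k x)\<^sup>2)) \<partial>\<mu>) = (\<Sum>k. \<integral>\<^sup>+x. ennreal (2^k * (D k x)\<^sup>2) \<partial>\<mu>)"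
    by (intro nn_integral_suminf) measurable
  also have "\<dots> \<le> (\<Sum>k. ennreal ((1/2)^k))"
  proof (intro suminf_le summableI)
    fix k
    have "(\<integral>\<^sup>+x. ennreal (2^k * (D k x)\<^sup>2) \<partial>\<mu>) = ennreal (2^k) * (\<integral>\<^sup>+x. ennreal ((D k x)\<^sup>2) \<partial>\<mu>)"
      by (simp add: ennreal_mult nn_integral_cmult)
    also have "\<dots> \<le> ennreal (2^k) * ennreal ((1/4)^k)"
      unfolding D_def nn_norm by (intro mult_left_mono ennreal_leI N r_N) auto
    also have "\<dots> = ennreal ((1/2)^k)"
      by (simp add: ennreal_mult[symmetric] power_mult_distrib[symmetric])
    finally show "(\<integral>\<^sup>+x. ennreal (2^k * (D k x)\<^sup>2) \<partial>\<mu>) \<le> ennreal ((1/2)^k)" .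
  qed
  also have "\<dots> < top"
    by (subst suminf_ennreal2) (auto intro!: summable_geometric)
  finally have "AE x in \<mu>. (\<Sum>k. ennreal (2^k * (D k x)\<^sup>2)) \<noteq> \<infinity>"
    by (intro nn_integral_PInf_AE) auto
  then have conv: "AE x in \<mu>. convergent (\<lambda>k. s (r k) x)"
  proof eventually_elim
    case (elim x)
    then have "summable (\<lambda>k. 2^k * (D k x)\<^sup>2)"
      by (intro summable_suminf_not_top) (auto simp: infinity_ennreal_def)
    then have "summable (\<lambda>k. (1/2)^k + 2^k * (D k x)\<^sup>2)"
      by (intro summable_add summable_geometric) auto
    moreover have "norm (D k x) \<le> (1/2)^k + 2^k * (D k x)\<^sup>2" for k
    proof (cases "\<bar>D k x\<bar> \<le> (1/2)^k")
      case False
      then have "1 \<le> 2^k * \<bar>D k x\<bar>" by (simp add: field_simps)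
      then have "1 * \<bar>D k x\<bar> \<le> (2^k * \<bar>D k x\<bar>) * \<bar>D k x\<bar>" by (intro mult_right_mono) auto
      then have "\<bar>D k x\<bar> \<le> 2^k * (D k x)\<^sup>2" by (simp add: power2_eq_square mult.assoc)
      then show ?thesis by (simp add: add_increasing)
    qed (simp add: add_increasing2)
    ultimately have "summable (\<lambda>k. D k x)" by (rule summable_comparison_test'[where N=0])
    then have "convergent (\<lambda>n. \<Sum>k<n. D k x)" by (simp add: summable_iff_convergent)
    moreover have "(\<Sum>k<n. D k x) = s (r n) x - s (r 0) x" for n
      unfolding D_def by (rule sum_lessThan_telescope)
    ultimately have "convergent (\<lambda>n. (s (r n) x - s (r 0) x) + s (r 0) x)"
      by (intro convergent_add convergent_const) simp
    then show ?case by simp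
  qed
  define h where "h x = lim (\<lambda>k. s (r k) x)" for x
  have [measurable]: "h \<in> borel_measurable \<mu>" unfolding h_def by measurable
  \<comment> \<open>Fatou is applied along \<open>r\<close> with \<open>n\<close> fixed, so the
    bound covers every \<open>n \<ge> N k\<close> and not just the subsequence.\<close>
  have bound: "(\<integral>\<^sup>+x. ennreal ((h x - s n x)\<^sup>2) \<partial>\<mu>) \<le> ennreal ((1/4)^k)" if "n \<ge> N k" for n k
  proof -
    have "(\<integral>\<^sup>+x. ennreal ((h x - s n x)\<^sup>2) \<partial>\<mu>) = (\<integral>\<^sup>+x. liminf (\<lambda>i. ennreal ((s (r i) x - s n x)\<^sup>2)) \<partial>\<mu>)"
    proof (rule nn_integral_cong_AE, use conv in eventually_elim)
      case (elim x)
      then have "(\<lambda>i. s (r i) x) \<longlonglongrightarrow> h x" unfolding h_def by (simp add: convergent_LIMSEQ_iff)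
      then have "(\<lambda>i. ennreal ((s (r i) x - s n x)\<^sup>2)) \<longlonglongrightarrow> ennreal ((h x - s n x)\<^sup>2)"
        by (intro tendsto_intros)
      then show ?case using lim_imp_Liminf[OF sequentially_bot] by metis
    qed
    also have "\<dots> \<le> liminf (\<lambda>i. \<integral>\<^sup>+x. ennreal ((s (r i) x - s n x)\<^sup>2) \<partial>\<mu>)"
      by (intro nn_integral_liminf) measurable
    also have "\<dots> \<le> liminf (\<lambda>i. ennreal ((1/4)^k))"
      unfolding nn_norm
      by (intro Liminf_mono eventually_sequentiallyI[of k] ennreal_leI N r_N that)
    also have "\<dots> = ennreal ((1/4)^k)" by (simp add: Liminf_const)
    finally show ?thesis .
  qed
  have diff: "(\<lambda>x. h x - s n x) \<in> L2_space \<mu>" if "n \<ge> N 0" for n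
  proof -
    have "(\<integral>\<^sup>+x. ennreal ((h x - s n x)\<^sup>2) \<partial>\<mu>) < \<infinity>"
      using bound[OF that] by (rule le_less_trans) simp
    then show ?thesis unfolding L2_space_def by (auto intro!: integrableI_bounded)
  qed
  have hL2: "h \<in> L2_space \<mu>"
    using L2_space_add[OF diff[OF order_refl] s[of "N 0"]] by simp
  have norm_le: "(L2_norm \<mu> (\<lambda>x. h x - s n x))\<^sup>2 \<le> (1/4)^k" if "n \<ge> N k" for n k
  proof -
    have "ennreal ((L2_norm \<mu> (\<lambda>x. h x - s n x))\<^sup>2) = (\<integral>\<^sup>+x. ennreal ((h x - s n x)\<^sup>2) \<partial>\<mu>)"
      unfolding L2_norm_power2
      by (intro nn_integral_eq_integral[symmetric] L2_space_integrable_power2 L2_space_diff s hL2) simp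
    also have "\<dots> \<le> ennreal ((1/4)^k)" by (rule bound[OF that])
    finally show ?thesis by (subst (asm) ennreal_le_iff) auto
  qed
  have "(\<lambda>n. L2_norm \<mu> (\<lambda>x. h x - s n x)) \<longlonglongrightarrow> 0"
  proof (rule LIMSEQ_I)
    fix \<epsilon> :: real assume "\<epsilon> > 0"
    then obtain k where k: "(1/4)^k < \<epsilon>\<^sup>2"
      using real_arch_pow_inv[of "\<epsilon>\<^sup>2" "1/4"] by auto
    have "L2_norm \<mu> (\<lambda>x. h x - s n x) < \<epsilon>" if "n \<ge> N k" for n
      using le_less_trans[OF norm_le[OF that] k] by (rule power2_less_imp_less) (use \<open>\<epsilon> > 0\<close> in simp)
    then show "\<exists>n0. \<forall>n\<ge>n0. norm (L2_norm \<mu> (\<lambda>x. h x - s n x) - 0) < \<epsilon>" by auto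
  qed
  with hL2 show ?thesis by blast
qed

section \<open>Orthonormal systems: Pythagoras, Bessel and convergence of series\<close>

definition orthonormal_in_L2 :: "'a measure \<Rightarrow> (nat \<Rightarrow> 'a \<Rightarrow> real) \<Rightarrow> bool" where
  "orthonormal_in_L2 \<mu> e \<longleftrightarrow>
     (\<forall>k. e k \<in> L2_space \<mu>) \<and> (\<forall>k l. L2_inner \<mu> (e k) (e l) = (if k = l then 1 else 0))"

lemma orthonormal_sum_in_L2:
  "orthonormal_in_L2 \<mu> e \<Longrightarrow> (\<lambda>x. \<Sum>k\<in>F. c k * e k x) \<in> L2_space \<mu>"
  unfolding orthonormal_in_L2_def by (intro L2_space_sum L2_space_scale) auto

lemma L2_inner_orthonormal_sum:
  assumes e: "orthonormal_in_L2 \<mu> e" and f: "f \<in> L2_space \<mu>"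
  shows "L2_inner \<mu> f (\<lambda>x. \<Sum>k\<in>F. c k * e k x) = (\<Sum>k\<in>F. c k * fourier_coeff \<mu> e f k)"
proof -
  have int: "integrable \<mu> (\<lambda>x. f x * e k x)" for k
    using e f unfolding orthonormal_in_L2_def by (intro L2_space_integrable_mult) auto
  have "L2_inner \<mu> f (\<lambda>x. \<Sum>k\<in>F. c k * e k x) = (\<integral>x. (\<Sum>k\<in>F. c k * (f x * e k x)) \<partial>\<mu>)"
    by (simp add: L2_inner_def sum_distrib_left mult.left_commute)
  also have "\<dots> = (\<Sum>k\<in>F. c k * fourier_coeff \<mu> e f k)"
    using int by (simp add: fourier_coeff_def)
  finally show ?thesis .
qed

lemma L2_norm_orthonormal_sum:
  assumes e: "orthonormal_in_L2 \<mu> e" and F: "finite F"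
  shows "(L2_norm \<mu> (\<lambda>x. \<Sum>k\<in>F. c k * e k x))\<^sup>2 = (\<Sum>k\<in>F. (c k)\<^sup>2)"
proof -
  have coeff: "fourier_coeff \<mu> e (\<lambda>x. \<Sum>l\<in>F. c l * e l x) k = c k" if "k \<in> F" for k
  proof -
    have ek: "e k \<in> L2_space \<mu>" using e by (simp add: orthonormal_in_L2_def)
    have "fourier_coeff \<mu> e (\<lambda>x. \<Sum>l\<in>F. c l * e l x) k = L2_inner \<mu> (e k) (\<lambda>x. \<Sum>l\<in>F. c l * e l x)"
      by (simp add: fourier_coeff_def L2_inner_def mult.commute)
    also have "\<dots> = (\<Sum>l\<in>F. c l * L2_inner \<mu> (e k) (e l))"
      unfolding L2_inner_orthonormal_sum[OF e ek] by (simp add: fourier_coeff_def L2_inner_def)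
    also have "\<dots> = (\<Sum>l\<in>F. if k = l then c l else 0)"
      using e unfolding orthonormal_in_L2_def by (intro sum.cong) auto
    also have "\<dots> = c k" using that F by simp
    finally show ?thesis .
  qed
  have "(L2_norm \<mu> (\<lambda>x. \<Sum>k\<in>F. c k * e k x))\<^sup>2 =
      L2_inner \<mu> (\<lambda>x. \<Sum>k\<in>F. c k * e k x) (\<lambda>x. \<Sum>k\<in>F. c k * e k x)"
    by (simp add: L2_norm_power2 L2_inner_def flip: power2_eq_square)
  also have "\<dots> = (\<Sum>k\<in>F. c k * c k)"
    unfolding L2_inner_orthonormal_sum[OF e orthonormal_sum_in_L2[OF e]] using coeff by simp
  finally show ?thesis by (simp add: power2_eq_square)
qed

text \<open>For the projection \<open>P\<close> of \<open>f\<close> onto the chosen span, the inner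
  product of \<open>f\<close> and \<open>P\<close> equals the squared norm of \<open>P\<close>;
  expanding the squared norm of f - P gives the claim.\<close>

lemma Bessel_inequality:
  assumes e: "orthonormal_in_L2 \<mu> e" and f: "f \<in> L2_space \<mu>" and F: "finite F"
  shows "(\<Sum>k\<in>F. (fourier_coeff \<mu> e f k)\<^sup>2) \<le> (L2_norm \<mu> f)\<^sup>2"
proof -
  define P where "P = (\<lambda>x. \<Sum>k\<in>F. fourier_coeff \<mu> e f k * e k x)"
  have P: "P \<in> L2_space \<mu>" unfolding P_def by (rule orthonormal_sum_in_L2[OF e])
  have "L2_inner \<mu> f P = (\<Sum>k\<in>F. (fourier_coeff \<mu> e f k)\<^sup>2)"
    unfolding P_def L2_inner_orthonormal_sum[OF e f] by (simp add: power2_eq_square)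
  moreover have "(L2_norm \<mu> P)\<^sup>2 = (\<Sum>k\<in>F. (fourier_coeff \<mu> e f k)\<^sup>2)"
    unfolding P_def by (rule L2_norm_orthonormal_sum[OF e F])
  ultimately show ?thesis
    using L2_norm_lincomb_power2[OF f P, of 1 "-1"]
      zero_le_power2[of "L2_norm \<mu> (\<lambda>x. 1 * f x + - 1 * P x)"] by simp
qed

text \<open>By Pythagoras the squared distance of two partial sums is a block of the series of
  squared coefficients.\<close>

lemma orthonormal_series_converges:
  assumes e: "orthonormal_in_L2 \<mu> e" and c: "summable (\<lambda>k. (c k)\<^sup>2)"
  shows "\<exists>h\<in>L2_space \<mu>. (\<lambda>N. L2_norm \<mu> (\<lambda>x. h x - (\<Sum>k<N. c k * e k x))) \<longlonglongrightarrow> 0"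
proof (rule L2_space_complete)
  show "(\<lambda>x. \<Sum>k<N. c k * e k x) \<in> L2_space \<mu>" for N by (rule orthonormal_sum_in_L2[OF e])
  fix \<epsilon> :: real assume "\<epsilon> > 0"
  then obtain N where N: "\<And>m n. m \<ge> N \<Longrightarrow> norm (\<Sum>k\<in>{m..<n}. (c k)\<^sup>2) < \<epsilon>"
    using c unfolding summable_Cauchy by metis
  define S where "S n x = (\<Sum>k<n. c k * e k x)" for n x
  have le: "(L2_norm \<mu> (\<lambda>x. S m x - S n x))\<^sup>2 \<le> \<epsilon>" if "N \<le> n" "n \<le> m" for m n
  proof -
    have "S m x - S n x = (\<Sum>k\<in>{n..<m}. c k * e k x)" for x
      unfolding S_def lessThan_atLeast0 using that by (intro sum_diff_nat_ivl) auto
    then have "(L2_norm \<mu> (\<lambda>x. S m x - S n x))\<^sup>2 = (\<Sum>k\<in>{n..<m}. (c k)\<^sup>2)"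
      by (simp add: L2_norm_orthonormal_sum[OF e])
    then show ?thesis using N[OF that(1), of m] by simp
  qed
  have "(L2_norm \<mu> (\<lambda>x. S m x - S n x))\<^sup>2 \<le> \<epsilon>" if "N \<le> n" "N \<le> m" for m n
    using le[of n m] le[of m n] that L2_norm_minus_commute[of \<mu> "S m" "S n"] by (cases "n \<le> m") auto
  then show "\<exists>N. \<forall>m\<ge>N. \<forall>n\<ge>N.
      (L2_norm \<mu> (\<lambda>x. (\<Sum>k<m. c k * e k x) - (\<Sum>k<n. c k * e k x)))\<^sup>2 \<le> \<epsilon>"
    unfolding S_def by blast
qed

section \<open>Wavelets and scattering\<close>

definition wavelet_generator :: "(real \<Rightarrow> real) \<Rightarrow> bool" where
  "wavelet_generator G \<longleftrightarrow> (\<forall>x\<ge>0. 0 \<le> G x) \<and> antimono_on {0..} G"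

lemma wavelet_generator_antimono:
  "wavelet_generator G \<Longrightarrow> 0 \<le> x \<Longrightarrow> x \<le> y \<Longrightarrow> G y \<le> G x"
  unfolding wavelet_generator_def by (metis atLeast_iff monotone_onD order_trans)

text \<open>\<open>0 \<le> lam k\<close> orders the two arguments of \<open>G\<close> inside its
  domain, so the radicand is nonnegative and squaring undoes the root.\<close>

lemma wavelet_hat_power2:
  assumes G: "wavelet_generator G" and k: "0 \<le> lam k"
  shows "(wavelet_hat G lam j k)\<^sup>2 = (G (2 powi (j - 1) * lam k))\<^sup>2 - (G (2 powi j * lam k))\<^sup>2"
proof -
  have "(2::real) powi (j - 1) \<le> 2 powi j" by (rule power_int_increasing) auto
  then have "2 powi (j - 1) * lam k \<le> 2 powi j * lam k" using k by (rule mult_right_mono)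
  then have "G (2 powi j * lam k) \<le> G (2 powi (j - 1) * lam k)"
    using k by (intro wavelet_generator_antimono[OF G]) auto
  moreover have "0 \<le> G (2 powi j * lam k)" using G k unfolding wavelet_generator_def by auto
  ultimately have "(G (2 powi j * lam k))\<^sup>2 \<le> (G (2 powi (j - 1) * lam k))\<^sup>2" by (rule power_mono)
  then show ?thesis unfolding wavelet_hat_def by simp
qed

lemma sum_wavelet_hat_power2_le:
  assumes G: "wavelet_generator G" and k: "0 \<le> lam k" and J: "finite J"
  shows "(\<Sum>j\<in>J. (wavelet_hat G lam j k)\<^sup>2) \<le> (G 0)\<^sup>2"
proof -
  \<comment> \<open>Telescoping needs consecutive scales, so \<open>J\<close> is enlarged to an
    integer interval.\<close>
  obtain a n where J_sub: "J \<subseteq> (\<lambda>i. a + int i) ` {..<n}"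
  proof
    show "J \<subseteq> (\<lambda>i. Min J + int i) ` {..<Suc (nat (Max J - Min J))}"
    proof
      fix j assume j: "j \<in> J"
      then have "Min J \<le> j" "j \<le> Max J" using J by auto
      then show "j \<in> (\<lambda>i. Min J + int i) ` {..<Suc (nat (Max J - Min J))}"
        by (intro image_eqI[of _ _ "nat (j - Min J)"]) auto
    qed
  qed
  have "(\<Sum>j\<in>J. (wavelet_hat G lam j k)\<^sup>2) \<le> (\<Sum>j\<in>(\<lambda>i. a + int i) ` {..<n}. (wavelet_hat G lam j k)\<^sup>2)"
    using J_sub by (intro sum_mono2) auto
  also have "\<dots> = (\<Sum>i<n. (G (2 powi (a + int i - 1) * lam k))\<^sup>2 - (G (2 powi (a + int (Suc i) - 1) * lam k))\<^sup>2)"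
    by (subst sum.reindex) (auto simp: inj_on_def wavelet_hat_power2[of G lam, OF G k] add.commute add.left_commute)
  also have "\<dots> = (G (2 powi (a - 1) * lam k))\<^sup>2 - (G (2 powi (a + int n - 1) * lam k))\<^sup>2"
    by (subst sum_lessThan_telescope') simp
  also have "\<dots> \<le> (G (2 powi (a - 1) * lam k))\<^sup>2" by simp
  \<comment> \<open>Origin of the constant: \<open>G 0\<close> is the largest value of
    \<open>G\<close>, whatever the coarsest or finest scale in \<open>J\<close>.\<close>
  also have "\<dots> \<le> (G 0)\<^sup>2"
    using G k by (intro power_mono wavelet_generator_antimono[OF G]) (auto simp: wavelet_generator_def)
  finally show ?thesis .
qed

text \<open>The choice in \<open>wavelet_conv\<close> meets its specification once some limit
  exists: Bessel makes the coefficients square summable, and the multipliers are bounded by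
  \<open>G 0\<close>.\<close>

lemma wavelet_conv_converges:
  assumes e: "orthonormal_in_L2 \<mu> e" and G: "wavelet_generator G" and lam: "\<forall>k. 0 \<le> lam k"
    and f: "f \<in> L2_space \<mu>"
  shows "wavelet_conv \<mu> lam e G f j \<in> L2_space \<mu>"
    and "(\<lambda>N. L2_norm \<mu> (\<lambda>x. wavelet_conv \<mu> lam e G f j x -
      (\<Sum>k<N. fourier_coeff \<mu> e f k * wavelet_hat G lam j k * e k x))) \<longlonglongrightarrow> 0"
proof -
  have hat_le: "(fourier_coeff \<mu> e f k * wavelet_hat G lam j k)\<^sup>2 \<le> (fourier_coeff \<mu> e f k)\<^sup>2 * (G 0)\<^sup>2" for k
    using sum_wavelet_hat_power2_le[of G lam k "{j}", OF G] lam
    by (simp add: power_mult_distrib mult_left_mono)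
  have "summable (\<lambda>k. (fourier_coeff \<mu> e f k)\<^sup>2)"
    using Bessel_inequality[OF e f] by (intro bounded_imp_summable[of _ "(L2_norm \<mu> f)\<^sup>2"]) auto
  then have "summable (\<lambda>k. (fourier_coeff \<mu> e f k)\<^sup>2 * (G 0)\<^sup>2)"
    by (rule summable_mult2)
  then have "summable (\<lambda>k. (fourier_coeff \<mu> e f k * wavelet_hat G lam j k)\<^sup>2)"
    by (rule summable_comparison_test'[where N=0]) (simp add: hat_le)
  from someI_ex[OF orthonormal_series_converges[OF e this, unfolded Bex_def]]
  have "wavelet_conv \<mu> lam e G f j \<in> L2_space \<mu> \<and>
      (\<lambda>N. L2_norm \<mu> (\<lambda>x. wavelet_conv \<mu> lam e G f j x -
      (\<Sum>k<N. fourier_coeff \<mu> e f k * wavelet_hat G lam j k * e k x))) \<longlonglongrightarrow> 0"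
    unfolding wavelet_conv_def .
  then show "wavelet_conv \<mu> lam e G f j \<in> L2_space \<mu>"
    and "(\<lambda>N. L2_norm \<mu> (\<lambda>x. wavelet_conv \<mu> lam e G f j x -
      (\<Sum>k<N. fourier_coeff \<mu> e f k * wavelet_hat G lam j k * e k x))) \<longlonglongrightarrow> 0"
    by blast+
qed

text \<open>A Plancherel identity for the difference of two independently chosen representatives.
  Norms of the partial sums for f - g converge to the norm of that difference by the triangle
  inequality, and Pythagoras computes them.\<close>

lemma wavelet_conv_diff_norm:
  assumes e: "orthonormal_in_L2 \<mu> e" and G: "wavelet_generator G" and lam: "\<forall>k. 0 \<le> lam k"
    and f: "f \<in> L2_space \<mu>" and g: "g \<in> L2_space \<mu>"
  shows "(\<lambda>N. \<Sum>k<N. (fourier_coeff \<mu> e (\<lambda>x. f x - g x) k * wavelet_hat G lam j k)\<^sup>2)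
    \<longlonglongrightarrow> (L2_norm \<mu> (\<lambda>x. wavelet_conv \<mu> lam e G f j x - wavelet_conv \<mu> lam e G g j x))\<^sup>2"
proof -
  define S where "S u N x = (\<Sum>k<N. fourier_coeff \<mu> e u k * wavelet_hat G lam j k * e k x)" for u N x
  have S: "S u N \<in> L2_space \<mu>" for u N
    unfolding S_def by (rule orthonormal_sum_in_L2[OF e])
  define F H where "F = wavelet_conv \<mu> lam e G f j" "H = wavelet_conv \<mu> lam e G g j"
  have F: "F \<in> L2_space \<mu>" "(\<lambda>N. L2_norm \<mu> (\<lambda>x. F x - S f N x)) \<longlonglongrightarrow> 0"
    and H: "H \<in> L2_space \<mu>" "(\<lambda>N. L2_norm \<mu> (\<lambda>x. H x - S g N x)) \<longlonglongrightarrow> 0"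
    using wavelet_conv_converges[OF e G lam] f g unfolding F_H_def S_def by auto
  define T where "T = S (\<lambda>x. f x - g x)"
  have coeff: "fourier_coeff \<mu> e (\<lambda>x. f x - g x) k = fourier_coeff \<mu> e f k - fourier_coeff \<mu> e g k" for k
    using e f g by (simp add: fourier_coeff_def left_diff_distrib L2_space_integrable_mult orthonormal_in_L2_def)
  have T: "T N x = S f N x - S g N x" for N x
    unfolding T_def S_def coeff by (simp add: left_diff_distrib sum_subtractf)
  have "(\<lambda>N. L2_norm \<mu> (T N)) \<longlonglongrightarrow> L2_norm \<mu> (\<lambda>x. F x - H x)"
  proof (rule LIM_zero_cancel, rule Lim_null_comparison)
    show "(\<lambda>N. L2_norm \<mu> (\<lambda>x. F x - S f N x) + L2_norm \<mu> (\<lambda>x. H x - S g N x)) \<longlonglongrightarrow> 0"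
      using tendsto_add[OF F(2) H(2)] by simp
    show "\<forall>\<^sub>F N in sequentially. norm (L2_norm \<mu> (T N) - L2_norm \<mu> (\<lambda>x. F x - H x))
        \<le> L2_norm \<mu> (\<lambda>x. F x - S f N x) + L2_norm \<mu> (\<lambda>x. H x - S g N x)"
    proof (intro always_eventually allI)
      fix N
      have TL: "T N \<in> L2_space \<mu>" unfolding T_def by (rule S)
      have "norm (L2_norm \<mu> (T N) - L2_norm \<mu> (\<lambda>x. F x - H x)) \<le> L2_norm \<mu> (\<lambda>x. T N x - (F x - H x))"
        unfolding real_norm_def by (intro L2_norm_reverse_triangle TL L2_space_diff F(1) H(1))
      also have "(\<lambda>x. T N x - (F x - H x)) = (\<lambda>x. (S f N x - F x) + (H x - S g N x))"
        by (simp add: T algebra_simps)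
      also have "L2_norm \<mu> \<dots> \<le> L2_norm \<mu> (\<lambda>x. S f N x - F x) + L2_norm \<mu> (\<lambda>x. H x - S g N x)"
        by (intro L2_norm_triangle L2_space_diff S F(1) H(1))
      finally show "norm (L2_norm \<mu> (T N) - L2_norm \<mu> (\<lambda>x. F x - H x))
        \<le> L2_norm \<mu> (\<lambda>x. F x - S f N x) + L2_norm \<mu> (\<lambda>x. H x - S g N x)"
        by (simp add: L2_norm_minus_commute[of \<mu> "S f N"])
    qed
  qed
  then have "(\<lambda>N. (L2_norm \<mu> (T N))\<^sup>2) \<longlonglongrightarrow> (L2_norm \<mu> (\<lambda>x. F x - H x))\<^sup>2" by (rule tendsto_power)
  moreover have "(L2_norm \<mu> (T N))\<^sup>2 =
      (\<Sum>k<N. (fourier_coeff \<mu> e (\<lambda>x. f x - g x) k * wavelet_hat G lam j k)\<^sup>2)" for N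
    unfolding T_def S_def by (rule L2_norm_orthonormal_sum[OF e]) simp
  ultimately show ?thesis by (simp add: F_H_def)
qed

text \<open>It suffices to bound the truncations at \<open>N\<close> uniformly; there both sums are
  finite, and after swapping them the scales telescope for each \<open>k\<close> separately.\<close>

lemma sum_wavelet_conv_diff_le:
  assumes e: "orthonormal_in_L2 \<mu> e" and G: "wavelet_generator G" and lam: "\<forall>k. 0 \<le> lam k"
    and f: "f \<in> L2_space \<mu>" and g: "g \<in> L2_space \<mu>" and J: "finite J"
  shows "(\<Sum>j\<in>J. (L2_norm \<mu> (\<lambda>x. wavelet_conv \<mu> lam e G f j x - wavelet_conv \<mu> lam e G g j x))\<^sup>2)
    \<le> (G 0)\<^sup>2 * (L2_norm \<mu> (\<lambda>x. f x - g x))\<^sup>2"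
proof -
  let ?d = "fourier_coeff \<mu> e (\<lambda>x. f x - g x)"
  have lim: "(\<lambda>N. \<Sum>j\<in>J. \<Sum>k<N. (?d k * wavelet_hat G lam j k)\<^sup>2) \<longlonglongrightarrow>
      (\<Sum>j\<in>J. (L2_norm \<mu> (\<lambda>x. wavelet_conv \<mu> lam e G f j x - wavelet_conv \<mu> lam e G g j x))\<^sup>2)"
    by (rule tendsto_sum) (rule wavelet_conv_diff_norm[OF e G lam f g])
  have "(\<Sum>j\<in>J. \<Sum>k<N. (?d k * wavelet_hat G lam j k)\<^sup>2)
      \<le> (G 0)\<^sup>2 * (L2_norm \<mu> (\<lambda>x. f x - g x))\<^sup>2" for N
  proof -
    have "(\<Sum>j\<in>J. \<Sum>k<N. (?d k * wavelet_hat G lam j k)\<^sup>2) =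
        (\<Sum>k<N. (?d k)\<^sup>2 * (\<Sum>j\<in>J. (wavelet_hat G lam j k)\<^sup>2))"
      by (subst sum.swap) (simp add: sum_distrib_left power_mult_distrib)
    also have "\<dots> \<le> (\<Sum>k<N. (?d k)\<^sup>2 * (G 0)\<^sup>2)"
      by (intro sum_mono mult_left_mono sum_wavelet_hat_power2_le G spec[OF lam] J) simp
    also have "\<dots> = (G 0)\<^sup>2 * (\<Sum>k<N. (?d k)\<^sup>2)"
      by (simp add: sum_distrib_left mult.commute)
    also have "\<dots> \<le> (G 0)\<^sup>2 * (L2_norm \<mu> (\<lambda>x. f x - g x))\<^sup>2"
      by (intro mult_left_mono Bessel_inequality[OF e] L2_space_diff f g) auto
    finally show ?thesis .
  qed
  then show ?thesis by (intro LIMSEQ_le_const2[OF lim]) blast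
qed

section \<open>Composing layers and summing over paths\<close>

lemma L2_norm_mono:
  assumes "f \<in> L2_space \<mu>" "h \<in> L2_space \<mu>" "\<And>x. \<bar>f x\<bar> \<le> \<bar>h x\<bar>"
  shows "L2_norm \<mu> f \<le> L2_norm \<mu> h"
  unfolding L2_norm_def using assms
  by (auto intro!: integral_mono L2_space_integrable_power2 simp: abs_le_square_iff)

lemma scattering_U_in_L2:
  assumes e: "orthonormal_in_L2 \<mu> e" and G: "wavelet_generator G" and lam: "\<forall>k. 0 \<le> lam k"
    and f: "f \<in> L2_space \<mu>"
  shows "scattering_U \<mu> lam e G js f \<in> L2_space \<mu>"
  using f
proof (induction js arbitrary: f)
  case (Cons j js)
  then show ?case
    using L2_space_abs[OF wavelet_conv_converges(1)[OF e G lam Cons.prems]] by simp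
qed simp

text \<open>Since the head index acts first, the induction fixes it and applies the hypothesis to
  the two outputs of the first layer; hence \<open>f\<close>, \<open>g\<close> and \<open>F\<close>
  are generalized.\<close>

lemma sum_scattering_U_diff_le:
  assumes e: "orthonormal_in_L2 \<mu> e" and G: "wavelet_generator G" and lam: "\<forall>k. 0 \<le> lam k"
    and f: "f \<in> L2_space \<mu>" and g: "g \<in> L2_space \<mu>" and F: "finite F" "F \<subseteq> int_tuples m"
  shows "(\<Sum>js\<in>F. (L2_norm \<mu> (\<lambda>x. scattering_U \<mu> lam e G js f x - scattering_U \<mu> lam e G js g x))\<^sup>2)
    \<le> G 0 ^ (2 * m) * (L2_norm \<mu> (\<lambda>x. f x - g x))\<^sup>2"
  using f g F
proof (induction m arbitrary: f g F)
  case 0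
  then have "F \<subseteq> {[]}" by (auto simp: int_tuples_def)
  then consider "F = {}" | "F = {[]}" by blast
  then show ?case by cases auto
next
  case (Suc m)
  define \<Delta> where "\<Delta> js u v = (L2_norm \<mu> (\<lambda>x. scattering_U \<mu> lam e G js u x - scattering_U \<mu> lam e G js v x))\<^sup>2"
    for js u v
  define V where "V u j = (\<lambda>x. \<bar>wavelet_conv \<mu> lam e G u j x\<bar>)" for u j
  note W = wavelet_conv_converges(1)[OF e G lam]
  have V: "V u j \<in> L2_space \<mu>" if "u \<in> L2_space \<mu>" for u j
    unfolding V_def using that by (intro L2_space_abs W)
  \<comment> \<open>\<open>F\<close> need not be a product, so it is enlarged to all paths with a
    head in \<open>?J\<close> and a tail in \<open>?T\<close>.\<close>
  let ?J = "hd ` F" and ?T = "tl ` F"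
  have F_sub: "F \<subseteq> (\<lambda>(j, js). j # js) ` (?J \<times> ?T)"
  proof
    fix js assume js: "js \<in> F"
    then have "js \<noteq> []" using Suc.prems(4) by (auto simp: int_tuples_def)
    then show "js \<in> (\<lambda>(j, js). j # js) ` (?J \<times> ?T)"
      using js by (intro image_eqI[of _ _ "(hd js, tl js)"]) auto
  qed
  have "(\<Sum>js\<in>F. \<Delta> js f g) \<le> (\<Sum>js\<in>(\<lambda>(j, js). j # js) ` (?J \<times> ?T). \<Delta> js f g)"
    using F_sub Suc.prems(3) by (intro sum_mono2) (auto simp: \<Delta>_def)
  also have "\<dots> = (\<Sum>j\<in>?J. \<Sum>js\<in>?T. \<Delta> js (V f j) (V g j))"
    by (subst sum.reindex) (auto simp: inj_on_def sum.cartesian_product \<Delta>_def V_def intro!: sum.cong)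
  also have "\<dots> \<le> (\<Sum>j\<in>?J. G 0 ^ (2 * m) * (L2_norm \<mu> (\<lambda>x. V f j x - V g j x))\<^sup>2)"
    unfolding \<Delta>_def
    by (intro sum_mono Suc.IH V Suc.prems(1,2)) (use Suc.prems(3,4) in \<open>auto simp: int_tuples_def\<close>)
  \<comment> \<open>Here the moduli are dropped: taking absolute values does not increase distances
    pointwise.\<close>
  also have "\<dots> \<le> (\<Sum>j\<in>?J. G 0 ^ (2 * m) *
      (L2_norm \<mu> (\<lambda>x. wavelet_conv \<mu> lam e G f j x - wavelet_conv \<mu> lam e G g j x))\<^sup>2)"
    by (intro sum_mono mult_left_mono power_mono L2_norm_mono L2_space_diff V W Suc.prems(1,2))
      (auto simp: V_def)
  also have "\<dots> \<le> G 0 ^ (2 * m) * ((G 0)\<^sup>2 * (L2_norm \<mu> (\<lambda>x. f x - g x))\<^sup>2)"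
    unfolding sum_distrib_left[symmetric]
    by (intro mult_left_mono sum_wavelet_conv_diff_le e G lam Suc.prems(1,2)) (use Suc.prems(3) in auto)
  also have "\<dots> = G 0 ^ (2 * Suc m) * (L2_norm \<mu> (\<lambda>x. f x - g x))\<^sup>2"
    by (simp add: power2_eq_square)
  finally show ?case by (simp add: \<Delta>_def)
qed

text \<open>The reverse triangle inequality on each path reduces this to the previous bound, uniform
  over finite sets of paths. Summability is stated alongside, since an infinite sum of a family that
  is not summable defaults to 0 and would satisfy the inequality vacuously.\<close>

lemma scattering_S2_contraction:
  assumes e: "orthonormal_in_L2 \<mu> e" and G: "wavelet_generator G" and lam: "\<forall>k. 0 \<le> lam k"
    and f: "f \<in> L2_space \<mu>" and g: "g \<in> L2_space \<mu>"
  defines "a \<equiv> \<lambda>js. scattering_S2 \<mu> lam e G f js - scattering_S2 \<mu> lam e G g js"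
  shows "in_l2 (int_tuples m) a"
    and "(l2_norm (int_tuples m) a)\<^sup>2 \<le> G 0 ^ (2 * m) * (L2_norm \<mu> (\<lambda>x. f x - g x))\<^sup>2"
proof -
  let ?B = "G 0 ^ (2 * m) * (L2_norm \<mu> (\<lambda>x. f x - g x))\<^sup>2"
  have bound: "(\<Sum>js\<in>F. \<bar>a js\<bar>\<^sup>2) \<le> ?B" if "finite F" "F \<subseteq> int_tuples m" for F
  proof -
    have "\<bar>a js\<bar> \<le> L2_norm \<mu> (\<lambda>x. scattering_U \<mu> lam e G js f x - scattering_U \<mu> lam e G js g x)" for js
      unfolding a_def scattering_S2_def
      by (intro L2_norm_reverse_triangle scattering_U_in_L2 e G lam f g)
    then have "(\<Sum>js\<in>F. \<bar>a js\<bar>\<^sup>2) \<le>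
        (\<Sum>js\<in>F. (L2_norm \<mu> (\<lambda>x. scattering_U \<mu> lam e G js f x - scattering_U \<mu> lam e G js g x))\<^sup>2)"
      by (intro sum_mono power_mono) auto
    also have "\<dots> \<le> ?B" by (rule sum_scattering_U_diff_le[OF e G lam f g that])
    finally show ?thesis .
  qed
  have summable: "(\<lambda>js. \<bar>a js\<bar>\<^sup>2) summable_on int_tuples m"
    using bound by (intro nonneg_bdd_above_summable_on bdd_aboveI[of _ ?B]) auto
  then show "in_l2 (int_tuples m) a" unfolding in_l2_def .
  have "(\<Sum>\<^sub>\<infinity>js\<in>int_tuples m. \<bar>a js\<bar>\<^sup>2) \<le> ?B"
    using summable bound by (rule infsum_le_finite_sums)
  then show "(l2_norm (int_tuples m) a)\<^sup>2 \<le> ?B"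
    unfolding l2_norm_def by (simp add: infsum_nonneg)
qed

theorem theorem9:
  fixes M :: "(real^'d::finite) set"
    and met :: "real^'d \<Rightarrow> real^'d \<Rightarrow> real^'d \<Rightarrow> real"
    and \<mu> :: "(real^'d) measure"
    and lam :: "nat \<Rightarrow> real"
    and e :: "nat \<Rightarrow> real^'d \<Rightarrow> real"
    and G :: "real \<Rightarrow> real"
    and C :: real
    and m :: nat
    and f g :: "real^'d \<Rightarrow> real"
  assumes "CARD('n::finite) \<le> CARD('d)"
    and "compact_riemannian_manifold TYPE('n) M met"
    and "riemannian_volume TYPE('n) M met \<mu>"
    and "laplace_eigenbasis TYPE('n) M met \<mu> lam e"
    and "\<And>x. x \<ge> 0 \<Longrightarrow> G x \<ge> 0"
    and "antimono_on {0..} G"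
    and "continuous_on {0..} G"
    and "G 0 = C" and "0 < C"
    and "(G \<longlongrightarrow> 0) at_top"
    and "m \<ge> 1"
    and "f \<in> L2_space \<mu>" and "g \<in> L2_space \<mu>"
  shows "in_l2 (int_tuples m)
           (\<lambda>js. scattering_S2 \<mu> lam e G f js - scattering_S2 \<mu> lam e G g js) \<and>
         (l2_norm (int_tuples m)
           (\<lambda>js. scattering_S2 \<mu> lam e G f js - scattering_S2 \<mu> lam e G g js))\<^sup>2
           \<le> C ^ (2 * m) * (L2_norm \<mu> (\<lambda>x. f x - g x))\<^sup>2"
proof -
  have e: "orthonormal_in_L2 \<mu> e"
    using assms(4) unfolding laplace_eigenbasis_def L2_orthonormal_basis_def orthonormal_in_L2_def by blast
  have G: "wavelet_generator G"
    using assms(5,6) unfolding wavelet_generator_def by blast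
  have space: "space \<mu> = M"
    using assms(3) sets_eq_imp_space_eq[of \<mu> "restrict_space borel M"]
    unfolding riemannian_volume_def by (simp add: space_restrict_space)
  have lam: "\<forall>k. 0 \<le> lam k"
  proof
    fix k
    \<comment> \<open>A function of norm one cannot vanish on all of \<open>M\<close>; the maximum
      principle starts from such a point.\<close>
    have "\<exists>q\<in>M. e k q \<noteq> 0"
    proof (rule ccontr)
      assume "\<not> (\<exists>q\<in>M. e k q \<noteq> 0)"
      then have "L2_inner \<mu> (e k) (e k) = (\<integral>x. 0 \<partial>\<mu>)"
        unfolding L2_inner_def by (intro Bochner_Integration.integral_cong) (auto simp: space)
      with e show False unfolding orthonormal_in_L2_def by simp
    qed
    then obtain q where "q \<in> M" "e k q \<noteq> 0" by blast
    with assms(2,4) show "0 \<le> lam k"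
      unfolding laplace_eigenbasis_def by (intro eigenvalue_nonneg[of M met "e k" "lam k" q]) blast+
  qed
  show ?thesis
    using scattering_S2_contraction[OF e G lam assms(12,13)] assms(8) by blast
qed

end
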